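(* Let $\alpha$ be an invertible linear operator in the space $\mathbb{R}^n$, and put $K=\operatorname{Ker}(I+\alpha)$. Let $\xi_1$ and $\xi_2$ be independent random vectors with values in $\mathbb{R}^n$ and distributions $\mu_1$ and $\mu_2$. Assume that the conditional distribution of the linear form $L_2=\xi_1+\alpha\xi_2$ given $L_1=\xi_1+\xi_2$ is symmetric. Then there exists an $\alpha$-invariant subspace $G$ of $\mathbb{R}^n$ with $K\cap G=\{0\}$ such that $\mu_1$ and $\mu_2$ are shifts of convolutions of symmetric Gaussian distributions supported in $G$ and a distribution supported in $K$; that is, there exist symmetric Gaussian distributions $\gamma_1,\gamma_2$ supported in $G$, a probability distribution $\omega$ supported in $K$, and vectors $x_1,x_2\in\mathbb{R}^n$ such that $\mu_j=\gamma_j*\omega*E_{x_j}$ for $j=1,2$.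
   Context: $I$ is the identity operator on $\mathbb{R}^n$. Distributions are Borel probability measures on $\mathbb{R}^n$; $E_x$ is the degenerate distribution concentrated at $x\in\mathbb{R}^n$, $*$ is convolution, and a shift of a distribution $\mu$ is a distribution $\mu*E_x$ with $x\in\mathbb{R}^n$. A distribution is supported in a subspace if that subspace has full measure. A Gaussian distribution on $\mathbb{R}^n$ is one with characteristic function $y\mapsto\exp\{-\langle Ay,y\rangle+i\langle b,y\rangle\}$, where $A$ is a symmetric positive semidefinite $n\times n$ matrix and $b\in\mathbb{R}^n$ (so degenerate distributions are Gaussian); it is symmetric if $b=0$. The conditional distribution of a random vector $L_2$ given $L_1$ is called symmetric if, for almost every value of $L_1$, the conditional distribution of $L_2$ given $L_1$ is invariant under $x\mapsto -x$; equivalently, the random vectors $(L_1,L_2)$ and $(L_1,-L_2)$ are identically distributed. *)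

theory Defs
  imports "HOL-Probability.Probability"
begin

definition is_distribution :: "'a::topological_space measure \<Rightarrow> bool" where
  "is_distribution \<mu> \<longleftrightarrow> prob_space \<mu> \<and> sets \<mu> = sets borel"

text \<open>The subspaces this is applied to are closed, hence Borel; a set that is not measurable
  has \<^const>\<open>emeasure\<close> zero and so never satisfies the condition.\<close>

definition supported_in :: "'a::topological_space measure \<Rightarrow> 'a set \<Rightarrow> bool" where
  "supported_in \<mu> S \<longleftrightarrow> emeasure \<mu> S = 1"

text \<open>The library's \<^const>\<open>char\<close> is restricted to measures on the real line.\<close>

definition char_fun :: "(real ^ 'n) measure \<Rightarrow> real ^ 'n \<Rightarrow> complex" where
  "char_fun \<mu> y = (CLINT x|\<mu>. iexp (x \<bullet> y))"

definition gaussian_with :: "(real ^ 'n) measure \<Rightarrow> real ^ 'n ^ 'n \<Rightarrow> real ^ 'n \<Rightarrow> bool" where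
  "gaussian_with \<mu> A b \<longleftrightarrow>
     is_distribution \<mu> \<and>
     transpose A = A \<and> (\<forall>y. 0 \<le> (A *v y) \<bullet> y) \<and>
     (\<forall>y. char_fun \<mu> y = exp (- complex_of_real ((A *v y) \<bullet> y) + \<i> * complex_of_real (b \<bullet> y)))"

definition symmetric_gaussian :: "(real ^ 'n) measure \<Rightarrow> bool" where
  "symmetric_gaussian \<mu> \<longleftrightarrow> (\<exists>A. gaussian_with \<mu> A 0)"

text \<open>\<open>\<kappa>\<close> is a regular conditional distribution of \<open>Y\<close> given \<open>X\<close>: a Markov kernel that
  disintegrates the joint law of \<open>X\<close> and \<open>Y\<close> over the law of \<open>X\<close>.\<close>

definition cond_distribution ::
  "'m measure \<Rightarrow> ('m \<Rightarrow> real ^ 'n) \<Rightarrow> ('m \<Rightarrow> real ^ 'n) \<Rightarrow> (real ^ 'n \<Rightarrow> (real ^ 'n) measure) \<Rightarrow> bool"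
where
  "cond_distribution M Y X \<kappa> \<longleftrightarrow>
     \<kappa> \<in> borel \<rightarrow>\<^sub>M prob_algebra borel \<and>
     (\<forall>A\<in>sets borel. \<forall>B\<in>sets borel.
        emeasure M {\<omega> \<in> space M. X \<omega> \<in> A \<and> Y \<omega> \<in> B} =
        (\<integral>\<^sup>+x\<in>A. emeasure (\<kappa> x) B \<partial>distr M borel X))"

text \<open>On \<open>\<real>\<^sup>n\<close> a regular conditional distribution always exists and is unique up to a null set of
  values of \<open>X\<close>, so it does not matter which version is required to be symmetric.\<close>

definition symmetric_cond_distribution ::
  "'m measure \<Rightarrow> ('m \<Rightarrow> real ^ 'n) \<Rightarrow> ('m \<Rightarrow> real ^ 'n) \<Rightarrow> bool"
where
  "symmetric_cond_distribution M Y X \<longleftrightarrow>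
     (\<exists>\<kappa>. cond_distribution M Y X \<kappa> \<and>
          (AE x in distr M borel X. distr (\<kappa> x) borel uminus = \<kappa> x))"

end

theory Submission
  imports Defs
begin

text \<open>
  Write \<open>f\<^sub>1\<close>, \<open>f\<^sub>2\<close> for the characteristic functions and \<open>\<beta>\<close> for the adjoint of \<open>\<alpha>\<close>. The symmetry of
  the conditional distribution means that
  \<open>f\<^sub>1 (u + v) * f\<^sub>2 (u + \<beta> v) = f\<^sub>1 (u - v) * f\<^sub>2 (u - \<beta> v)\<close>.
  Let \<open>\<pi>\<close> be the spectral projection of \<open>I - \<beta>\<^sup>2\<close> that kills the generalised eigenspaces of \<open>\<beta>\<close>
  for the eigenvalues \<open>\<plusminus> 1\<close>, and let \<open>G\<close> be the range of its adjoint.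

  On the range of \<open>\<pi>\<close>, where \<open>\<beta>\<close> and \<open>I \<plusminus> \<beta>\<close> are invertible, third differences of \<open>log f\<^sub>j\<close> vanish
  as long as \<open>f\<^sub>1\<close> and \<open>f\<^sub>2\<close> have no zeros nearby. Hence \<open>|f\<^sub>j y| = |f\<^sub>j (y / 2)| ^ 4\<close> up to the first zero
  on a ray, so there is no zero at all, and \<open>log f\<^sub>j\<close> is a quadratic polynomial.

  On the intersection \<open>F\<close> of the kernel of \<open>\<pi>\<close> with the range of \<open>I + \<beta>\<close>, the annihilator of \<open>K\<close>,
  an induction along the generalised eigenspaces shows \<open>|f\<^sub>j| = 1\<close>, so there the distributions are
  degenerate. Since \<open>I + \<beta>\<close> maps the kernel of \<open>\<pi>\<close> into \<open>F\<close>, the functional equation then yields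
  \<open>f\<^sub>j (y + h) = f\<^sub>j y * f\<^sub>j h\<close> for \<open>\<pi> y = y\<close> and \<open>\<pi> h = 0\<close>, and it makes \<open>f\<^sub>1\<close> and \<open>f\<^sub>2\<close> agree on
  the kernel of \<open>\<pi>\<close> up to a character.
\<close>

subsection \<open>Uniqueness of characteristic functions on the euclidean space\<close>

text \<open>The transforms at \<open>t = 0\<close> are the total masses, so these agree. If the
  common mass is zero, both measures vanish; otherwise dividing by it reduces the claim to
  \<open>Levy_uniqueness\<close>. Finite measures are the right generality because the weighted
  marginals to which this is applied are not normalised.\<close>

lemma finite_measure_char_unique:
  fixes M1 M2 :: "real measure"
  assumes fin: "finite_measure M1" "finite_measure M2"
    and sets: "sets M1 = sets borel" "sets M2 = sets borel"
    and eq: "\<And>t. (CLINT x|M1. iexp (t * x)) = (CLINT x|M2. iexp (t * x))"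
  shows "M1 = M2"
proof -
  interpret M1: finite_measure M1 by fact
  interpret M2: finite_measure M2 by fact
  note [measurable_cong] = sets
  have sp: "space M1 = UNIV" "space M2 = UNIV"
    using sets_eq_imp_space_eq[OF sets(1)] sets_eq_imp_space_eq[OF sets(2)] by auto
  define c where "c = measure M1 UNIV"
  have c2: "c = measure M2 UNIV"
    using eq[of 0] sp by (simp add: c_def)
  show ?thesis
  proof (cases "c = 0")
    case True
    have "emeasure M1 A = 0" "emeasure M2 A = 0" for A
      using True c2 sp emeasure_space[of M1 A] emeasure_space[of M2 A]
      by (auto simp: c_def M1.emeasure_eq_measure M2.emeasure_eq_measure measure_le_0_iff)
    then show ?thesis
      using sets by (intro measure_eqI) auto
  next
    case False
    then have c: "c > 0"
      using measure_nonneg[of M1 UNIV] unfolding c_def by linarith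
    define s where "s M = density M (\<lambda>_. ennreal (1 / c))" for M :: "real measure"
    have s: "real_distribution (s M)" "char (s M) t = (CLINT x|M. iexp (t * x)) / c"
      if "finite_measure M" and M[measurable_cong]: "sets M = sets borel"
        and cM: "c = measure M UNIV" and sp: "space M = UNIV" for M t
    proof -
      interpret M: finite_measure M by fact
      have "emeasure (s M) (space (s M)) = 1"
        using c sp cM[symmetric]
        by (simp add: s_def emeasure_density_const M.emeasure_eq_measure ennreal_mult[symmetric])
      then have "prob_space (s M)"
        by (rule prob_spaceI)
      then show "real_distribution (s M)"
        by (simp add: real_distribution_def real_distribution_axioms_def s_def M)
      show "char (s M) t = (CLINT x|M. iexp (t * x)) / c"
        unfolding char_def s_def using c
        by (subst integral_density) (auto simp: scaleR_conv_of_real integral_divide_zero field_simps)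
    qed
    have "s M1 = s M2"
      using sp sets fin c2 c_def eq by (intro Levy_uniqueness s ext) (auto simp: s(2))
    show ?thesis
    proof (rule measure_eqI)
      fix A assume "A \<in> sets M1"
      then have A: "A \<in> sets M1" "A \<in> sets M2" using sets by auto
      have "emeasure (s M1) A = emeasure (s M2) A"
        using \<open>s M1 = s M2\<close> by simp
      then show "emeasure M1 A = emeasure M2 A"
        using A c unfolding s_def
        by (simp add: emeasure_density_const M1.emeasure_eq_measure M2.emeasure_eq_measure
            ennreal_mult[symmetric] del: ennreal_inj) (simp add: measure_nonneg)
    qed (simp add: sets)
  qed
qed

lemma is_distributionD:
  assumes "is_distribution \<mu>"
  shows "prob_space \<mu>" "sets \<mu> = sets borel" "space \<mu> = UNIV"
  using assms sets_eq_imp_space_eq[of \<mu> borel] by (auto simp: is_distribution_def)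

lemma integrable_iexp_weight:
  fixes \<mu> :: "(real^'n) measure" and \<psi> :: "real^'n \<Rightarrow> real"
  assumes \<mu>: "is_distribution \<mu>"
    and [measurable]: "\<psi> \<in> borel_measurable borel" and B: "\<And>x. \<bar>\<psi> x\<bar> \<le> B"
  shows "integrable \<mu> (\<lambda>x. complex_of_real (\<psi> x) * iexp (x \<bullet> y))"
proof -
  interpret prob_space \<mu> using \<mu> by (simp add: is_distribution_def)
  note [measurable_cong] = is_distributionD(2)[OF \<mu>]
  show ?thesis
    by (rule integrable_const_bound[of _ B]) (auto simp: norm_mult B)
qed

text \<open>The induction step that inserts indicators one coordinate at a time. Weighting by
  \<open>\<psi>\<close> and a trigonometric polynomial in \<open>x \<bullet> y\<close> and
  projecting to coordinate \<open>k\<close> gives finite measures on the line, whose transforms are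
  combinations of the integrals assumed equal.\<close>

lemma weighted_iexp_marginal:
  fixes \<mu> \<nu> :: "(real^'n) measure" and \<psi> :: "real^'n \<Rightarrow> real"
  assumes \<mu>: "is_distribution \<mu>" and \<nu>: "is_distribution \<nu>"
    and \<psi>[measurable]: "\<psi> \<in> borel_measurable borel" and \<psi>01: "\<And>x. 0 \<le> \<psi> x" "\<And>x. \<psi> x \<le> 1"
    and eq: "\<And>y. (CLINT x|\<mu>. \<psi> x * iexp (x \<bullet> y)) = (CLINT x|\<nu>. \<psi> x * iexp (x \<bullet> y))"
    and B[measurable]: "B \<in> sets borel"
  shows "(CLINT x|\<mu>. indicator B (x $ k) * \<psi> x * iexp (x \<bullet> y)) =
         (CLINT x|\<nu>. indicator B (x $ k) * \<psi> x * iexp (x \<bullet> y))"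
proof -
  note cong = is_distributionD(2)[OF \<mu>] is_distributionD(2)[OF \<nu>]
  note [measurable_cong] = cong
  have bd: "\<bar>\<psi> x\<bar> \<le> 1" for x using \<psi>01[of x] by auto
  \<comment> \<open>Adding 1 to the cosine and sine parts of the exponential makes the weights nonnegative, so
    that the one-dimensional uniqueness theorem for measures applies.\<close>
  have main: "(LINT x|\<mu>. \<psi> x * w x * indicator B (x $ k)) = (LINT x|\<nu>. \<psi> x * w x * indicator B (x $ k))"
    if w: "\<And>x. w x = 1 + a * cos (x \<bullet> y) + b * sin (x \<bullet> y)" and ab: "\<And>x. 0 \<le> w x"
    for w :: "real^'n \<Rightarrow> real" and a b :: real
  proof -
    have [measurable]: "w \<in> borel_measurable borel"
      unfolding w[abs_def] by measurable
    define D where "D m = distr (density m (\<lambda>x. ennreal (\<psi> x * w x))) borel (\<lambda>x::real^'n. x $ k)" for m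
    \<comment> \<open>In exponential form, \<open>w x\<close> is 1 plus
      \<open>(a - b * \<i>) / 2\<close> times \<open>iexp (x \<bullet> y)\<close> plus the conjugate
      term. Hence the transform of \<open>D m\<close> at \<open>t\<close> involves only the weighted
      integrals at \<open>axis k t\<close>, \<open>axis k t + y\<close> and
      \<open>axis k t - y\<close>.\<close>
    have D: "finite_measure (D m)" "sets (D m) = sets borel"
        "(CLINT s|D m. iexp (t * s)) = (CLINT x|m. \<psi> x * iexp (x \<bullet> axis k t))
          + (a - b * \<i>) / 2 * (CLINT x|m. \<psi> x * iexp (x \<bullet> (axis k t + y)))
          + (a + b * \<i>) / 2 * (CLINT x|m. \<psi> x * iexp (x \<bullet> (axis k t - y)))"
        "(LINT s|D m. indicator B s) = (LINT x|m. \<psi> x * w x * indicator B (x $ k))"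
      if m: "is_distribution m" for m t
    proof -
      interpret m: prob_space m using m by (simp add: is_distribution_def)
      note [measurable_cong] = is_distributionD(2)[OF m]
      note int = integrable_iexp_weight[OF m \<psi> bd]
      have "w x \<le> 1 + \<bar>a\<bar> + \<bar>b\<bar>" for x
        using mult_mono[OF order_refl abs_cos_le_one[of "x \<bullet> y"], of "\<bar>a\<bar>"]
              mult_mono[OF order_refl abs_sin_le_one[of "x \<bullet> y"], of "\<bar>b\<bar>"]
        unfolding w by (auto simp: abs_mult[symmetric])
      then have wb: "norm (\<psi> x * w x) \<le> 1 * (1 + \<bar>a\<bar> + \<bar>b\<bar>)" for x
        unfolding real_norm_def abs_mult using bd[of x] ab[of x] by (intro mult_mono) auto
      have wint: "integrable m (\<lambda>x. \<psi> x * w x)"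
        using wb by (intro m.integrable_const_bound[of _ "1 * (1 + \<bar>a\<bar> + \<bar>b\<bar>)"]) auto
      have "finite_measure (density m (\<lambda>x. ennreal (\<psi> x * w x)))"
        using wint \<psi>01 ab
        by (intro finite_measureI) (auto simp: emeasure_density nn_integral_eq_integral cong: nn_integral_cong)
      then show "finite_measure (D m)"
        unfolding D_def by (rule finite_measure.finite_measure_distr) measurable
      show "sets (D m) = sets borel" by (simp add: D_def)
      have "(CLINT s|D m. iexp (t * s)) = (CLINT x|m. (\<psi> x * w x) *\<^sub>R iexp (t * x $ k))"
        unfolding D_def using \<psi>01 ab by (subst integral_distr, simp, simp, subst integral_density) auto
      also have "\<dots> = (CLINT x|m. \<psi> x * iexp (x \<bullet> axis k t)
          + (a - b * \<i>) / 2 * (\<psi> x * iexp (x \<bullet> (axis k t + y)))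
          + (a + b * \<i>) / 2 * (\<psi> x * iexp (x \<bullet> (axis k t - y))))"
        by (intro Bochner_Integration.integral_cong refl)
          (simp add: w complex_eq_iff Re_exp Im_exp inner_axis inner_add_right inner_diff_right
            cos_add cos_diff sin_add sin_diff algebra_simps add_divide_distrib diff_divide_distrib)
      also have "\<dots> = (CLINT x|m. \<psi> x * iexp (x \<bullet> axis k t))
          + (a - b * \<i>) / 2 * (CLINT x|m. \<psi> x * iexp (x \<bullet> (axis k t + y)))
          + (a + b * \<i>) / 2 * (CLINT x|m. \<psi> x * iexp (x \<bullet> (axis k t - y)))"
        using int by (subst Bochner_Integration.integral_add | simp)+
      finally show "(CLINT s|D m. iexp (t * s)) = \<dots>" .
      show "(LINT s|D m. indicator B s) = (LINT x|m. \<psi> x * w x * indicator B (x $ k))"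
        unfolding D_def using \<psi>01 ab by (subst integral_distr, simp, simp, subst integral_density) auto
    qed
    have "D \<mu> = D \<nu>"
      by (rule finite_measure_char_unique) (use D \<mu> \<nu> eq in auto)
    then show ?thesis
      using D(4)[OF \<mu>] D(4)[OF \<nu>] by simp
  qed
  have w0: "(LINT x|\<mu>. \<psi> x * 1 * indicator B (x $ k)) = (LINT x|\<nu>. \<psi> x * 1 * indicator B (x $ k))"
    by (rule main[of _ 0 0]) auto
  have "- 1 \<le> cos t" "- 1 \<le> sin t" for t :: real by auto
  then have cs: "0 \<le> 1 + cos t" "0 \<le> 1 + sin t" for t :: real
    by (smt (verit))+
  have "cos t \<le> 1" "sin t \<le> 1" for t :: real by auto
  then have abs1: "\<bar>1 + cos t\<bar> \<le> 2" "\<bar>1 + sin t\<bar> \<le> 2" for t :: real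
    using cs[of t] by (smt (verit))+
  have wc: "(LINT x|\<mu>. \<psi> x * (1 + cos (x \<bullet> y)) * indicator B (x $ k)) = (LINT x|\<nu>. \<psi> x * (1 + cos (x \<bullet> y)) * indicator B (x $ k))"
    by (rule main[of _ 1 0]) (auto simp: cs)
  have ws: "(LINT x|\<mu>. \<psi> x * (1 + sin (x \<bullet> y)) * indicator B (x $ k)) = (LINT x|\<nu>. \<psi> x * (1 + sin (x \<bullet> y)) * indicator B (x $ k))"
    by (rule main[of _ 0 1]) (auto simp: cs)
  \<comment> \<open>The exponential is recovered from the three nonnegative weights as
    \<open>(1 + cos) + \<i> * (1 + sin) - (1 + \<i>)\<close>.\<close>
  have dec: "(CLINT x|m. indicator B (x $ k) * \<psi> x * iexp (x \<bullet> y)) =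
      of_real (LINT x|m. \<psi> x * (1 + cos (x \<bullet> y)) * indicator B (x $ k))
      + \<i> * of_real (LINT x|m. \<psi> x * (1 + sin (x \<bullet> y)) * indicator B (x $ k))
      - (1 + \<i>) * of_real (LINT x|m. \<psi> x * 1 * indicator B (x $ k))" if m: "is_distribution m" for m
  proof -
    interpret m: prob_space m using m by (simp add: is_distribution_def)
    note [measurable_cong] = is_distributionD(2)[OF m]
    have "integrable m (\<lambda>x. complex_of_real (\<psi> x * w x * indicator B (x $ k)))"
      if [measurable]: "w \<in> borel_measurable borel" and w: "\<And>x. \<bar>w x\<bar> \<le> 2" for w
    proof (rule m.integrable_const_bound[of _ "1 * 2"])
      show "AE x in m. cmod (complex_of_real (\<psi> x * w x * indicator B (x $ k))) \<le> 1 * 2"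
      proof (rule AE_I2)
        fix x
        have "\<bar>\<psi> x\<bar> * \<bar>w x\<bar> \<le> 1 * 2"
          using bd w by (intro mult_mono) auto
        then show "cmod (complex_of_real (\<psi> x * w x * indicator B (x $ k))) \<le> 1 * 2"
          by (auto simp: norm_mult abs_mult indicator_def)
      qed
    qed measurable
    from this[of "\<lambda>x. 1 + cos (x \<bullet> y)"] this[of "\<lambda>x. 1 + sin (x \<bullet> y)"] this[of "\<lambda>_. 1"]
    have I: "integrable m (\<lambda>x. complex_of_real (\<psi> x * (1 + cos (x \<bullet> y)) * indicator B (x $ k)))"
      "integrable m (\<lambda>x. complex_of_real (\<psi> x * (1 + sin (x \<bullet> y)) * indicator B (x $ k)))"
      "integrable m (\<lambda>x. complex_of_real (\<psi> x * 1 * indicator B (x $ k)))"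
      using abs1 by auto
    have "(CLINT x|m. indicator B (x $ k) * \<psi> x * iexp (x \<bullet> y)) =
      (CLINT x|m. of_real (\<psi> x * (1 + cos (x \<bullet> y)) * indicator B (x $ k))
      + \<i> * of_real (\<psi> x * (1 + sin (x \<bullet> y)) * indicator B (x $ k))
      - (1 + \<i>) * of_real (\<psi> x * 1 * indicator B (x $ k)))"
      by (intro Bochner_Integration.integral_cong refl)
        (simp add: complex_eq_iff Re_exp Im_exp indicator_def algebra_simps)
    also have "\<dots> = (CLINT x|m. of_real (\<psi> x * (1 + cos (x \<bullet> y)) * indicator B (x $ k)))
      + \<i> * (CLINT x|m. of_real (\<psi> x * (1 + sin (x \<bullet> y)) * indicator B (x $ k)))
      - (1 + \<i>) * (CLINT x|m. of_real (\<psi> x * 1 * indicator B (x $ k)))"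
      using I by (simp only: Bochner_Integration.integral_diff Bochner_Integration.integral_add
          integral_mult_right_zero Bochner_Integration.integrable_add integrable_mult_right)
    also have "\<dots> = of_real (LINT x|m. \<psi> x * (1 + cos (x \<bullet> y)) * indicator B (x $ k))
      + \<i> * of_real (LINT x|m. \<psi> x * (1 + sin (x \<bullet> y)) * indicator B (x $ k))
      - (1 + \<i>) * of_real (LINT x|m. \<psi> x * 1 * indicator B (x $ k))"
      unfolding integral_complex_of_real ..
    finally show ?thesis .
  qed
  show ?thesis
    unfolding dec[OF \<mu>] dec[OF \<nu>] w0 wc ws ..
qed

text \<open>With the indicators of all coordinates inserted, the case \<open>y = 0\<close> says that
  both measures agree on the lower orthants \<open>{..a}\<close>, an intersection-stable generator
  of the Borel sets.\<close>

theorem char_fun_unique: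
  fixes \<mu> \<nu> :: "(real^'n) measure"
  assumes \<mu>: "is_distribution \<mu>" and \<nu>: "is_distribution \<nu>"
    and eq: "\<And>y. char_fun \<mu> y = char_fun \<nu> y"
  shows "\<mu> = \<nu>"
proof -
  have rect: "(CLINT x|\<mu>. complex_of_real (\<Prod>i\<in>S. indicator (A i) (x $ i)) * iexp (x \<bullet> y)) =
      (CLINT x|\<nu>. complex_of_real (\<Prod>i\<in>S. indicator (A i) (x $ i)) * iexp (x \<bullet> y))"
    if A: "\<And>i. A i \<in> sets (borel :: real measure)" for S :: "'n set" and A y
    using finite[of S]
  proof (induction S arbitrary: y rule: finite_induct)
    case empty
    then show ?case using eq by (simp add: char_fun_def)
  next
    case (insert k S)
    note [measurable] = A
    define \<psi> :: "real^'n \<Rightarrow> real" where "\<psi> x = (\<Prod>i\<in>S. indicator (A i) (x $ i))" for x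
    have "(CLINT x|\<mu>. indicator (A k) (x $ k) * \<psi> x * iexp (x \<bullet> y)) =
         (CLINT x|\<nu>. indicator (A k) (x $ k) * \<psi> x * iexp (x \<bullet> y))"
    proof (rule weighted_iexp_marginal[OF \<mu> \<nu>])
      show "\<psi> \<in> borel_measurable borel"
        unfolding \<psi>_def[abs_def] by measurable
      show "0 \<le> \<psi> x" for x unfolding \<psi>_def by (rule prod_nonneg) auto
      show "\<psi> x \<le> 1" for x unfolding \<psi>_def by (rule prod_le_1) (auto simp: indicator_def)
      show "(CLINT x|\<mu>. \<psi> x * iexp (x \<bullet> y)) = (CLINT x|\<nu>. \<psi> x * iexp (x \<bullet> y))" for y
        unfolding \<psi>_def by (rule insert.IH)
    qed (rule A)
    then show ?case
      using insert.hyps by (simp add: \<psi>_def)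
  qed
  let ?E = "range (\<lambda>a::real^'n. {..a})"
  show ?thesis
  proof (rule measure_eqI_generator_eq[where E = ?E and \<Omega> = UNIV and A = "\<lambda>n. {..(\<chi> j. real n)}"])
    show "Int_stable ?E"
    proof (rule Int_stableI)
      fix a b assume "a \<in> ?E" "b \<in> ?E"
      then obtain u v where "a = {..u}" "b = {..v}" by auto
      then have "a \<inter> b = {..inf u v}" by auto
      then show "a \<inter> b \<in> ?E" by auto
    qed
    show "sets \<mu> = sigma_sets UNIV ?E" "sets \<nu> = sigma_sets UNIV ?E"
      using is_distributionD(2)[OF \<mu>] is_distributionD(2)[OF \<nu>]
      by (simp_all add: borel_eq_atMost)
    fix X assume "X \<in> ?E"
    then obtain a where X: "X = {..a}" by auto
    have m: "(CLINT x|m. complex_of_real (\<Prod>i\<in>UNIV. indicator {..a $ i} (x $ i)) * iexp (x \<bullet> 0)) = complex_of_real (measure m X)"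
      if m: "is_distribution m" for m
    proof -
      interpret m: prob_space m using m by (simp add: is_distribution_def)
      note [measurable_cong] = is_distributionD(2)[OF m]
      have "complex_of_real (\<Prod>i\<in>UNIV. indicator {..a $ i} (x $ i)) * iexp (x \<bullet> 0) = complex_of_real (indicator X x)" for x
      proof (cases "x \<in> X")
        case False
        then obtain i where "x $ i \<notin> {..a $ i}" unfolding X by (auto simp: less_eq_vec_def)
        then have "(\<Prod>i\<in>UNIV. indicator {..a $ i} (x $ i)) = (0::real)"
          by (intro prod_zero) (auto intro!: exI[of _ i])
        with False show ?thesis by simp
      qed (auto simp: X less_eq_vec_def)
      then show ?thesis
        using is_distributionD(3)[OF m] by simp
    qed
    have "measure \<mu> X = measure \<nu> X"
      using rect[of "\<lambda>i. {..a $ i}" UNIV 0] unfolding m[OF \<mu>] m[OF \<nu>] of_real_eq_iff by simp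
    then show "emeasure \<mu> X = emeasure \<nu> X"
      using is_distributionD(1)[OF \<mu>] is_distributionD(1)[OF \<nu>]
      by (simp add: finite_measure.emeasure_eq_measure prob_space.finite_measure)
  next
    show "emeasure \<mu> {..(\<chi> j. real i)} \<noteq> \<infinity>" for i
      using is_distributionD(1)[OF \<mu>] by (simp add: finite_measure.emeasure_eq_measure prob_space.finite_measure)
    show "(\<Union>i. {..(\<chi> j. real i)}) = (UNIV :: (real^'n) set)"
    proof -
      have "\<exists>i. x \<le> (\<chi> j. real i)" for x :: "real^'n"
      proof -
        obtain n where n: "norm x \<le> real n" using real_arch_simple by blast
        have "x $ i \<le> real n" for i
          using component_le_norm_cart[of x i] n by linarith
        then show ?thesis
          by (intro exI[of _ n]) (auto simp: less_eq_vec_def)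
      qed
      then show ?thesis by auto
    qed
  qed auto
qed

subsection \<open>Characteristic functions\<close>

lemma is_distribution_distr:
  assumes "prob_space M" "X \<in> measurable M borel"
  shows "is_distribution (distr M borel X)"
  using assms by (simp add: is_distribution_def prob_space.prob_space_distr)

lemma char_fun_distr:
  assumes [measurable]: "X \<in> measurable M borel"
  shows "char_fun (distr M borel X) y = (CLINT \<omega>|M. iexp (X \<omega> \<bullet> y))"
  unfolding char_fun_def by (subst integral_distr) auto

lemma integrable_iexp_inner:
  fixes \<mu> :: "(real^'n) measure"
  assumes "is_distribution \<mu>"
  shows "integrable \<mu> (\<lambda>x. iexp (x \<bullet> y))"
  using integrable_iexp_weight[OF assms, of "\<lambda>_. 1" 1] by simp

lemma char_fun_0: "is_distribution \<mu> \<Longrightarrow> char_fun \<mu> 0 = 1"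
  by (simp add: char_fun_def is_distribution_def prob_space.prob_space)

lemma cmod_char_fun_le_1:
  assumes "is_distribution \<mu>"
  shows "cmod (char_fun \<mu> y) \<le> 1"
proof -
  interpret prob_space \<mu> using assms by (simp add: is_distribution_def)
  have "cmod (char_fun \<mu> y) \<le> (\<integral>x. norm (iexp (x \<bullet> y)) \<partial>\<mu>)"
    unfolding char_fun_def by (intro integral_norm_bound)
  also have "\<dots> \<le> 1"
    by (simp add: prob_space)
  finally show ?thesis .
qed

lemma char_fun_uminus:
  "char_fun \<mu> (- y) = cnj (char_fun \<mu> y)"
  unfolding char_fun_def by (subst Bochner_Integration.integral_cnj[symmetric]) (simp add: exp_cnj)

lemma continuous_on_char_fun:
  fixes \<mu> :: "(real^'n) measure"
  assumes "is_distribution \<mu>"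
  shows "continuous_on UNIV (char_fun \<mu>)"
proof (rule continuous_at_imp_continuous_on, rule ballI)
  fix y :: "real^'n"
  interpret prob_space \<mu> using assms by (simp add: is_distribution_def)
  note [measurable_cong] = is_distributionD(2)[OF assms]
  show "isCont (char_fun \<mu>) y"
    unfolding continuous_at_sequentially
  proof safe
    fix X assume X: "X \<longlonglongrightarrow> y"
    show "(char_fun \<mu> \<circ> X) \<longlonglongrightarrow> char_fun \<mu> y"
      unfolding comp_def char_fun_def
      by (rule integral_dominated_convergence[where w="\<lambda>_. 1"]) (auto intro!: tendsto_intros X)
  qed
qed

section \<open>Characteristic functions of affine images, convolutions and point masses\<close>

lemma linear_borel_measurable:
  fixes T :: "'a::euclidean_space \<Rightarrow> 'b::euclidean_space"
  shows "linear T \<Longrightarrow> T \<in> borel_measurable borel"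
  by (simp add: borel_measurable_continuous_onI linear_continuous_on linear_conv_bounded_linear)

lemma is_distribution_distr_affine:
  fixes T :: "real^'n \<Rightarrow> real^'n"
  assumes \<mu>: "is_distribution \<mu>" and T: "linear T"
  shows "is_distribution (distr \<mu> borel (\<lambda>x. T x + b))"
proof (rule is_distribution_distr)
  note [measurable] = linear_borel_measurable[OF T]
  show "(\<lambda>x. T x + b) \<in> \<mu> \<rightarrow>\<^sub>M borel"
    unfolding measurable_cong_sets[OF is_distributionD(2)[OF \<mu>] refl] by measurable
qed (rule is_distributionD(1)[OF \<mu>])

lemma char_fun_distr_affine:
  fixes T :: "real^'n \<Rightarrow> real^'n"
  assumes "is_distribution \<mu>" "linear T"
  shows "char_fun (distr \<mu> borel (\<lambda>x. T x + b)) y = char_fun \<mu> (adjoint T y) * iexp (b \<bullet> y)"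
proof -
  note [measurable_cong] = is_distributionD(2)[OF assms(1)]
  note [measurable] = linear_borel_measurable[OF assms(2)]
  have "char_fun (distr \<mu> borel (\<lambda>x. T x + b)) y = (CLINT x|\<mu>. iexp (x \<bullet> adjoint T y) * iexp (b \<bullet> y))"
    by (subst char_fun_distr)
      (auto simp: adjoint_works[OF assms(2)] inner_add_left distrib_left exp_add)
  then show ?thesis
    by (simp add: char_fun_def)
qed

lemma is_distribution_convolution:
  fixes \<mu> \<nu> :: "(real^'n) measure"
  assumes "is_distribution \<mu>" "is_distribution \<nu>"
  shows "is_distribution (\<mu> \<star> \<nu>)"
proof -
  interpret M: prob_space \<mu> using assms by (simp add: is_distribution_def)
  interpret N: prob_space \<nu> using assms by (simp add: is_distribution_def)
  interpret pair_prob_space \<mu> \<nu> ..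
  note [measurable_cong] = is_distributionD(2)[OF assms(1)] is_distributionD(2)[OF assms(2)]
  show ?thesis
    unfolding convolution_def by (intro is_distribution_distr) (auto intro: prob_space_axioms)
qed

lemma char_fun_convolution:
  fixes \<mu> \<nu> :: "(real^'n) measure"
  assumes "is_distribution \<mu>" "is_distribution \<nu>"
  shows "char_fun (\<mu> \<star> \<nu>) y = char_fun \<mu> y * char_fun \<nu> y"
proof -
  interpret M: prob_space \<mu> using assms by (simp add: is_distribution_def)
  interpret N: prob_space \<nu> using assms by (simp add: is_distribution_def)
  interpret pair_prob_space \<mu> \<nu> ..
  note [measurable_cong] = is_distributionD(2)[OF assms(1)] is_distributionD(2)[OF assms(2)]
  have int: "integrable (\<mu> \<Otimes>\<^sub>M \<nu>) (\<lambda>(x, z). iexp (x \<bullet> y) * iexp (z \<bullet> y))"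
    by (rule integrable_const_bound[of _ 1]) (auto simp: norm_mult)
  have "char_fun (\<mu> \<star> \<nu>) y = (CLINT p|\<mu> \<Otimes>\<^sub>M \<nu>. case p of (x, z) \<Rightarrow> iexp (x \<bullet> y) * iexp (z \<bullet> y))"
    unfolding convolution_def
    by (subst char_fun_distr)
      (auto simp: inner_add_left distrib_left exp_add intro!: Bochner_Integration.integral_cong)
  also have "\<dots> = (CLINT x|\<mu>. (CLINT z|\<nu>. iexp (x \<bullet> y) * iexp (z \<bullet> y)))"
    using integral_fst'[OF int] by simp
  also have "\<dots> = char_fun \<mu> y * char_fun \<nu> y"
    by (simp add: char_fun_def)
  finally show ?thesis .
qed

lemma is_distribution_return: "is_distribution (return borel b)"
  by (simp add: is_distribution_def prob_space_return)

lemma char_fun_return: "char_fun (return borel b) y = iexp (b \<bullet> y)"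
  unfolding char_fun_def by (subst integral_return) auto

text \<open>The equality case of the bound by 1: if \<open>?c\<close> is the value at
  \<open>w\<close>, the function \<open>1 - Re (cnj ?c * iexp (x \<bullet> w))\<close> is
  nonnegative with integral \<open>1 - |?c|^2 = 0\<close>, so it vanishes almost everywhere. A
  number of modulus 1 with real part 1 is 1.\<close>

lemma char_fun_unimodular_AE:
  fixes \<mu> :: "(real^'n) measure"
  assumes \<mu>: "is_distribution \<mu>" and w: "cmod (char_fun \<mu> w) = 1"
  shows "AE x in \<mu>. iexp (x \<bullet> w) = char_fun \<mu> w"
proof -
  interpret prob_space \<mu> using \<mu> by (simp add: is_distribution_def)
  note [measurable_cong] = is_distributionD(2)[OF \<mu>]
  let ?c = "char_fun \<mu> w"
  have cc: "?c * cnj ?c = 1"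
    using w complex_norm_square[of ?c] by simp
  let ?g = "\<lambda>x. 1 - Re (cnj ?c * iexp (x \<bullet> w))"
  have int: "integrable \<mu> (\<lambda>x. cnj ?c * iexp (x \<bullet> w))"
    using integrable_iexp_inner[OF \<mu>] by simp
  have le: "Re (cnj ?c * iexp (x \<bullet> w)) \<le> 1" for x
    using complex_Re_le_cmod[of "cnj ?c * iexp (x \<bullet> w)"] w by (simp add: norm_mult)
  have "(\<integral>x. ?g x \<partial>\<mu>) = 1 - Re (cnj ?c * ?c)"
    using integral_Re[OF int] integrable_Re[OF int]
    by (subst Bochner_Integration.integral_diff) (simp_all only: prob_space
        lebesgue_integral_const integrable_const integral_mult_right_zero char_fun_def[symmetric] scaleR_one)
  also have "\<dots> = 0"
    using cc by (simp add: mult.commute)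
  finally have "AE x in \<mu>. ?g x = 0"
    by (subst (asm) integral_nonneg_eq_0_iff_AE)
      (use le in \<open>auto simp del: times_complex.sel intro!: Bochner_Integration.integrable_diff integrable_Re[OF int]\<close>)
  then show ?thesis
  proof (rule AE_mp, intro AE_I2 impI)
    fix x assume "?g x = 0"
    then have re: "Re (cnj ?c * iexp (x \<bullet> w)) = 1" by simp
    have "cmod (cnj ?c * iexp (x \<bullet> w)) = 1"
      using w by (simp add: norm_mult)
    then have "(Im (cnj ?c * iexp (x \<bullet> w)))\<^sup>2 = 0"
      using re cmod_power2[of "cnj ?c * iexp (x \<bullet> w)"] by simp
    then have one: "cnj ?c * iexp (x \<bullet> w) = 1"
      using re by (simp add: complex_eq_iff)
    have "iexp (x \<bullet> w) = (?c * cnj ?c) * iexp (x \<bullet> w)"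
      unfolding cc by simp
    also have "\<dots> = ?c"
      using one by (simp add: mult.assoc)
    finally show "iexp (x \<bullet> w) = ?c" .
  qed
qed

text \<open>The factor \<open>iexp (x \<bullet> w)\<close> is almost surely constant and leaves the
  integral. All later multiplicativity of characteristic functions comes from here.\<close>

lemma char_fun_add_unimodular:
  fixes \<mu> :: "(real^'n) measure"
  assumes \<mu>: "is_distribution \<mu>" and w: "cmod (char_fun \<mu> w) = 1"
  shows "char_fun \<mu> (y + w) = char_fun \<mu> y * char_fun \<mu> w"
proof -
  note [measurable_cong] = is_distributionD(2)[OF \<mu>]
  have "char_fun \<mu> (y + w) = (CLINT x|\<mu>. iexp (x \<bullet> y) * iexp (x \<bullet> w))"
    by (simp add: char_fun_def inner_add_right distrib_left exp_add)
  also have "\<dots> = (CLINT x|\<mu>. iexp (x \<bullet> y) * char_fun \<mu> w)"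
    using char_fun_unimodular_AE[OF assms] by (intro integral_cong_AE) auto
  also have "\<dots> = char_fun \<mu> y * char_fun \<mu> w"
    by (simp add: char_fun_def)
  finally show ?thesis .
qed

text \<open>The distribution is degenerate in the directions of \<open>F\<close>: two points
  satisfying the almost sure identities on a basis have the same inner products with all of
  \<open>F\<close>.\<close>

lemma unimodular_subspace_AE:
  fixes \<mu> :: "(real^'n) measure"
  assumes \<mu>: "is_distribution \<mu>" and F: "subspace F"
    and w: "\<And>w. w \<in> F \<Longrightarrow> cmod (char_fun \<mu> w) = 1"
  obtains b where "AE x in \<mu>. \<forall>w\<in>F. x \<bullet> w = b \<bullet> w"
proof -
  interpret prob_space \<mu> using \<mu> by (simp add: is_distribution_def)
  obtain B where B: "B \<subseteq> F" "independent B" "F = span B"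
    using basis_exists[of F] span_subspace[OF _ _ F] by metis
  then have "finite B"
    using independent_imp_finite by blast
  \<comment> \<open>One identity fixes \<open>x \<bullet> v\<close> only modulo 2 pi. The dyadic
    multiples of a finite basis give countably many identities, which hold simultaneously almost
    surely and remove this ambiguity.\<close>
  define P where "P x = (\<forall>v\<in>B. \<forall>m::nat. iexp (x \<bullet> ((1 / 2 ^ m) *\<^sub>R v)) = char_fun \<mu> ((1 / 2 ^ m) *\<^sub>R v))" for x
  have P: "AE x in \<mu>. P x"
    unfolding P_def AE_finite_all[OF \<open>finite B\<close>] AE_all_countable
    by (intro ballI allI char_fun_unimodular_AE \<mu> w subspace_scale F) (use B(1) in auto)
  obtain b where b: "P b"
    using eventually_happens'[OF ae_filter_bot P] by blast
  have eq: "x \<bullet> v = b \<bullet> v" if x: "P x" and v: "v \<in> B" for x v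
  proof (rule ccontr)
    assume "x \<bullet> v \<noteq> b \<bullet> v"
    define d where "d = x \<bullet> v - b \<bullet> v"
    \<comment> \<open>At this scale the difference is below 1 in absolute value, while a nonzero
      multiple of 2 pi is not.\<close>
    obtain m :: nat where m: "\<bar>d\<bar> < 2 ^ m"
      using real_arch_pow[of 2 "\<bar>d\<bar>"] by auto
    have "iexp (x \<bullet> ((1 / 2 ^ m) *\<^sub>R v)) = iexp (b \<bullet> ((1 / 2 ^ m) *\<^sub>R v))"
      using x b v by (simp add: P_def)
    then obtain k :: int where "\<i> * (x \<bullet> ((1 / 2 ^ m) *\<^sub>R v)) = \<i> * (b \<bullet> ((1 / 2 ^ m) *\<^sub>R v)) + of_int (2 * k) * pi * \<i>"
      unfolding exp_eq by blast
    then have "d / 2 ^ m = 2 * k * pi"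
      by (simp add: complex_eq_iff d_def diff_divide_distrib)
    moreover have "\<bar>d / 2 ^ m\<bar> < 1" using m by (simp add: abs_divide)
    moreover have "d \<noteq> 0" using \<open>x \<bullet> v \<noteq> b \<bullet> v\<close> by (simp add: d_def)
    ultimately have "\<bar>2 * k * pi\<bar> < 1" "k \<noteq> 0" by auto
    moreover have "\<bar>2 * k * pi\<bar> \<ge> 2 * 1 * 1"
      unfolding abs_mult using \<open>k \<noteq> 0\<close> pi_gt3 by (intro mult_mono) auto
    ultimately show False by simp
  qed
  have "x \<bullet> w = b \<bullet> w" if "P x" "w \<in> F" for x w
    using that(2) unfolding B(3)
  proof (induction rule: span_induct_alt)
    case (step c v y) then show ?case using eq[OF that(1), of v] by (simp add: inner_add_right)
  qed simp
  then have "AE x in \<mu>. \<forall>w\<in>F. x \<bullet> w = b \<bullet> w"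
    using P by auto
  then show ?thesis by (rule that)
qed

subsection \<open>The Fitting decomposition\<close>

lemma funpow_commute_of_commute:
  assumes "\<And>y. \<beta> (T y) = T (\<beta> y)"
  shows "\<beta> ((T ^^ m) y) = (T ^^ m) (\<beta> y)"
  by (induction m) (simp_all add: assms)

lemma linear_funpow:
  fixes T :: "'a::real_vector \<Rightarrow> 'a"
  assumes "linear T"
  shows "linear (T ^^ m)"
proof (induction m)
  case 0
  show ?case using linear_id by (simp add: id_def)
next
  case (Suc m)
  then show ?case using linear_compose[OF Suc assms] by (simp only: funpow.simps)
qed

lemma subspace_ker: "linear A \<Longrightarrow> subspace {x. A x = 0}"
  by (auto simp: subspace_def linear_0 linear_add linear_cmul)

text \<open>The kernels of the powers of \<open>T\<close> grow and stabilise. For a stable power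
  \<open>A\<close>, the map \<open>A\<close> is bijective on its own range, and \<open>\<pi>\<close>
  applies \<open>A\<close> and then inverts it there: it projects onto the range of \<open>A\<close>
  along its kernel. Being built from \<open>T\<close> alone, it commutes with whatever commutes with
  \<open>T\<close>.\<close>

lemma fitting_projection:
  fixes T :: "'a::euclidean_space \<Rightarrow> 'a"
  assumes T: "linear T"
  obtains \<pi> m where "linear \<pi>" "\<And>y. \<pi> (\<pi> y) = \<pi> y"
    "\<And>y. T (\<pi> y) = 0 \<Longrightarrow> \<pi> y = 0" "\<And>y. \<pi> y = 0 \<Longrightarrow> (T ^^ m) y = 0"
    "\<And>\<beta> y. (\<And>y. \<beta> (T y) = T (\<beta> y)) \<Longrightarrow> \<beta> (\<pi> y) = \<pi> (\<beta> y)"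
proof -
  define ker where "ker m = {x. (T ^^ m) x = 0}" for m
  have lin: "linear (T ^^ m)" for m by (rule linear_funpow[OF T])
  have sub: "subspace (ker m)" for m unfolding ker_def by (rule subspace_ker[OF lin])
  have mono: "ker m \<subseteq> ker (m + k)" for m k
  proof
    fix x assume "x \<in> ker m"
    then have "(T ^^ (k + m)) x = 0"
      unfolding ker_def funpow_add using linear_0[OF lin] by simp
    then show "x \<in> ker (m + k)" by (simp add: ker_def add.commute)
  qed
  have "\<exists>m. \<forall>k. dim (ker k) \<le> dim (ker m)"
  proof -
    have "finite (range (\<lambda>m. dim (ker m)))"
      by (rule finite_subset[of _ "{..DIM('a)}"]) (auto intro: dim_subset_UNIV)
    then have le: "\<And>k. dim (ker k) \<le> Max (range (\<lambda>m. dim (ker m)))"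
        and "Max (range (\<lambda>m. dim (ker m))) \<in> range (\<lambda>m. dim (ker m))"
      by (auto intro!: Max_in)
    then obtain m where "Max (range (\<lambda>m. dim (ker m))) = dim (ker m)" by blast
    with le show ?thesis by (intro exI[of _ m]) simp
  qed
  then obtain n where n: "\<And>k. dim (ker k) \<le> dim (ker n)" by blast
  \<comment> \<open>The kernels are stable from \<open>n\<close> on. The successor makes the
    exponent positive, so that \<open>T (\<pi> y) = 0\<close> implies
    \<open>A (\<pi> y) = 0\<close>.\<close>
  define m where "m = Suc n"
  define A where "A = T ^^ m"
  have A: "linear A" unfolding A_def by (rule lin)
  have stable: "ker n = ker (n + k)" for k
    using subspace_dim_equal[OF sub sub mono n] by blast
  have "ker m = ker (m + m)"
    using stable[of 1] stable[of "1 + Suc n"] by (simp add: m_def)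
  then have kerA: "A x = 0" if "A (A x) = 0" for x
    using that by (auto simp: ker_def A_def funpow_add)
  have inj: "inj_on A (range A)"
  proof (rule inj_onI)
    fix x y assume "x \<in> range A" "y \<in> range A" "A x = A y"
    then obtain a b where ab: "x = A a" "y = A b" by auto
    then have "A (A (a - b)) = 0" using \<open>A x = A y\<close> by (simp add: linear_diff[OF A])
    then have "A (a - b) = 0" by (rule kerA)
    then show "x = y" using ab by (simp add: linear_diff[OF A])
  qed
  have subA: "subspace (range A)" by (rule linear_subspace_image[OF A subspace_UNIV])
  obtain R where R: "linear R" "\<And>v. v \<in> range A \<Longrightarrow> R (A v) = v"
    using linear_exists_left_inverse_on[OF A subA inj] by blast
  have "dim (A ` range A) = dim (range A)"
    by (rule dim_image_eq[OF A]) (use inj subA in \<open>simp add: span_eq_iff[THEN iffD2]\<close>)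
  then have rangeA: "A ` range A = range A"
    by (intro subspace_dim_equal linear_subspace_image[OF A] subA) auto
  define \<pi> where "\<pi> = R \<circ> A"
  have \<pi>_range: "\<pi> v = v" if "v \<in> range A" for v
    using R(2)[OF that] by (simp add: \<pi>_def)
  have \<pi>: "\<pi> y \<in> range A \<and> A (\<pi> y) = A y" for y
  proof -
    have "A y \<in> A ` range A" unfolding rangeA by simp
    then obtain z where z: "z \<in> range A" "A y = A z" by auto
    then have "\<pi> y = z" using R(2) by (simp add: \<pi>_def)
    then show ?thesis using z by simp
  qed
  show ?thesis
  proof
    show "linear \<pi>" unfolding \<pi>_def by (rule linear_compose[OF A R(1)])
    show "\<pi> (\<pi> y) = \<pi> y" for y using \<pi>[of y] by (auto intro: \<pi>_range)
    show "\<pi> y = 0" if "T (\<pi> y) = 0" for y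
    proof -
      have "A (\<pi> y) = 0"
        using that linear_0[OF lin] by (simp add: A_def m_def funpow_swap1)
      moreover have "0 \<in> range A" using subA subspace_0 by blast
      ultimately show ?thesis
        using inj \<pi>[of y] linear_0[OF A] by (metis inj_onD)
    qed
    show "(T ^^ m) y = 0" if "\<pi> y = 0" for y
      using \<pi>[of y] that linear_0[OF A] by (simp add: A_def)
    show "\<beta> (\<pi> y) = \<pi> (\<beta> y)" if cT: "\<And>y. \<beta> (T y) = T (\<beta> y)" for \<beta> y
    proof -
      have c: "\<beta> (A x) = A (\<beta> x)" for x
        unfolding A_def by (rule funpow_commute_of_commute[where T = T]) (rule cT)
      obtain w where "\<pi> y = A w" using \<pi> by blast
      then have "\<beta> (\<pi> y) \<in> range A" by (simp add: c)
      then have "\<beta> (\<pi> y) = R (A (\<beta> (\<pi> y)))" by (simp add: R(2))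
      also have "\<dots> = R (A (\<beta> y))" using \<pi>[of y] by (simp flip: c)
      finally show ?thesis by (simp add: \<pi>_def)
    qed
  qed
qed

subsection \<open>The functional equation\<close>

text \<open>Rectangles determine the joint law, and on \<open>A \<times> B\<close> it is the
  integral over \<open>A\<close> of the kernel measure of \<open>B\<close>. Symmetry of the kernel
  allows \<open>B\<close> to be replaced by its reflection under the integral.\<close>

lemma symmetric_cond_distribution_joint:
  fixes X Y :: "'m \<Rightarrow> real^'n"
  assumes M: "prob_space M" and X[measurable]: "X \<in> borel_measurable M" and Y[measurable]: "Y \<in> borel_measurable M"
    and sym: "symmetric_cond_distribution M Y X"
  shows "distr M (borel \<Otimes>\<^sub>M borel) (\<lambda>\<omega>. (X \<omega>, Y \<omega>)) = distr M (borel \<Otimes>\<^sub>M borel) (\<lambda>\<omega>. (X \<omega>, - Y \<omega>))"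
    (is "?D1 = ?D2")
proof -
  interpret prob_space M by fact
  obtain \<kappa> where \<kappa>: "\<kappa> \<in> borel \<rightarrow>\<^sub>M prob_algebra borel"
    and dis: "\<And>A B. A \<in> sets borel \<Longrightarrow> B \<in> sets borel \<Longrightarrow>
        emeasure M {\<omega> \<in> space M. X \<omega> \<in> A \<and> Y \<omega> \<in> B} =
        (\<integral>\<^sup>+x\<in>A. emeasure (\<kappa> x) B \<partial>distr M borel X)"
    and ae: "AE x in distr M borel X. distr (\<kappa> x) borel uminus = \<kappa> x"
    using sym unfolding symmetric_cond_distribution_def cond_distribution_def by blast
  have sets_\<kappa>: "sets (\<kappa> x) = sets borel" for x
    using measurable_space[OF \<kappa>, of x] by (simp add: space_prob_algebra)
  let ?E = "{a \<times> b | a b. a \<in> sets (borel :: (real^'n) measure) \<and> b \<in> sets (borel :: (real^'n) measure)}"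
  show ?thesis
  proof (rule measure_eqI_generator_eq[where E = ?E and \<Omega> = UNIV and A = "\<lambda>_. UNIV"])
    show "Int_stable ?E" by (rule Int_stable_pair_measure_generator)
    show "sets ?D1 = sigma_sets UNIV ?E" "sets ?D2 = sigma_sets UNIV ?E"
      by (simp_all add: sets_pair_measure)
    fix Z assume "Z \<in> ?E"
    then obtain A B where Z: "Z = A \<times> B" and AB[measurable]: "A \<in> sets borel" "B \<in> sets borel" by blast
    have mB[measurable]: "uminus -` B \<in> sets borel"
      using measurable_sets[of uminus borel borel B] by simp
    have "emeasure ?D1 Z = emeasure M {\<omega> \<in> space M. X \<omega> \<in> A \<and> Y \<omega> \<in> B}"
      unfolding Z by (subst emeasure_distr) (auto intro!: arg_cong[where f = "emeasure M"])
    also have "\<dots> = (\<integral>\<^sup>+x\<in>A. emeasure (\<kappa> x) B \<partial>distr M borel X)"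
      by (rule dis) fact+
    also have "\<dots> = (\<integral>\<^sup>+x\<in>A. emeasure (\<kappa> x) (uminus -` B) \<partial>distr M borel X)"
    proof (rule nn_integral_cong_AE, rule AE_mp[OF ae], rule AE_I2, rule impI)
      fix x assume "distr (\<kappa> x) borel uminus = \<kappa> x"
      then have "emeasure (\<kappa> x) B = emeasure (distr (\<kappa> x) borel uminus) B" by simp
      also have "\<dots> = emeasure (\<kappa> x) (uminus -` B)"
        using sets_\<kappa>[of x] sets_eq_imp_space_eq[OF sets_\<kappa>[of x]]
        by (subst emeasure_distr) (auto cong: measurable_cong_sets)
      finally show "emeasure (\<kappa> x) B * indicator A x = emeasure (\<kappa> x) (uminus -` B) * indicator A x"
        by simp
    qed
    also have "\<dots> = emeasure M {\<omega> \<in> space M. X \<omega> \<in> A \<and> Y \<omega> \<in> uminus -` B}"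
      by (rule dis[symmetric]) fact+
    also have "\<dots> = emeasure ?D2 Z"
      unfolding Z by (subst emeasure_distr) (auto intro!: arg_cong[where f = "emeasure M"])
    finally show "emeasure ?D1 Z = emeasure ?D2 Z" .
  next
    interpret D1: prob_space ?D1 by (rule prob_space_distr) simp
    show "emeasure ?D1 UNIV \<noteq> \<infinity>" by (simp add: D1.emeasure_eq_measure)
    show "range (\<lambda>_::nat. UNIV) \<subseteq> ?E" by (auto intro!: exI[of _ UNIV])
  qed auto
qed

text \<open>Both sides are the transform at \<open>(u, v)\<close> of the joint laws of
  \<open>(?X, ?Y)\<close> and \<open>(?X, - ?Y)\<close>. Collecting the terms of each random vector,
  with the adjoint moved onto \<open>v\<close>, and using independence gives the products.\<close>

lemma heyde_equation:
  fixes \<xi>\<^sub>1 \<xi>\<^sub>2 :: "'m \<Rightarrow> real^'n"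
  assumes \<alpha>: "linear \<alpha>" and M: "prob_space M"
    and ind: "prob_space.indep_var M borel \<xi>\<^sub>1 borel \<xi>\<^sub>2"
    and sym: "symmetric_cond_distribution M (\<lambda>\<omega>. \<xi>\<^sub>1 \<omega> + \<alpha> (\<xi>\<^sub>2 \<omega>)) (\<lambda>\<omega>. \<xi>\<^sub>1 \<omega> + \<xi>\<^sub>2 \<omega>)"
  shows "char_fun (distr M borel \<xi>\<^sub>1) (u + v) * char_fun (distr M borel \<xi>\<^sub>2) (u + adjoint \<alpha> v) =
         char_fun (distr M borel \<xi>\<^sub>1) (u - v) * char_fun (distr M borel \<xi>\<^sub>2) (u - adjoint \<alpha> v)"
proof -
  interpret prob_space M by fact
  have m[measurable]: "\<xi>\<^sub>1 \<in> borel_measurable M" "\<xi>\<^sub>2 \<in> borel_measurable M"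
    using indep_var_rv1[OF ind] indep_var_rv2[OF ind] by auto
  note [measurable] = linear_borel_measurable[OF \<alpha>]
  have ind2: "indep_var borel (\<lambda>\<omega>. iexp (\<xi>\<^sub>1 \<omega> \<bullet> a)) borel (\<lambda>\<omega>. iexp (\<xi>\<^sub>2 \<omega> \<bullet> b))" for a b
    using indep_var_compose[OF ind, of "\<lambda>x. iexp (x \<bullet> a)" borel "\<lambda>x. iexp (x \<bullet> b)" borel]
    by (simp add: comp_def)
  have int: "integrable M (\<lambda>\<omega>. iexp (X \<omega> \<bullet> a))" if "X \<in> borel_measurable M" for X :: "'m \<Rightarrow> real^'n" and a
    using that by (intro integrable_const_bound[of _ 1]) auto
  have prod: "char_fun (distr M borel \<xi>\<^sub>1) a * char_fun (distr M borel \<xi>\<^sub>2) b =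
      (CLINT \<omega>|M. iexp (\<xi>\<^sub>1 \<omega> \<bullet> a) * iexp (\<xi>\<^sub>2 \<omega> \<bullet> b))" for a b
    unfolding char_fun_distr[OF m(1)] char_fun_distr[OF m(2)]
    by (rule indep_var_lebesgue_integral[OF ind2 int int, symmetric]) (rule m)+
  let ?X = "\<lambda>\<omega>. \<xi>\<^sub>1 \<omega> + \<xi>\<^sub>2 \<omega>" and ?Y = "\<lambda>\<omega>. \<xi>\<^sub>1 \<omega> + \<alpha> (\<xi>\<^sub>2 \<omega>)"
  let ?g = "\<lambda>p. iexp (fst p \<bullet> u + snd p \<bullet> v)"
  have joint: "distr M (borel \<Otimes>\<^sub>M borel) (\<lambda>\<omega>. (?X \<omega>, ?Y \<omega>)) = distr M (borel \<Otimes>\<^sub>M borel) (\<lambda>\<omega>. (?X \<omega>, - ?Y \<omega>))"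
    by (rule symmetric_cond_distribution_joint[OF M _ _ sym]) measurable
  have "char_fun (distr M borel \<xi>\<^sub>1) (u + v) * char_fun (distr M borel \<xi>\<^sub>2) (u + adjoint \<alpha> v) =
      (CLINT p|distr M (borel \<Otimes>\<^sub>M borel) (\<lambda>\<omega>. (?X \<omega>, ?Y \<omega>)). ?g p)"
    unfolding prod
    by (subst integral_distr)
      (auto intro!: Bochner_Integration.integral_cong
        simp: exp_add inner_add_left inner_add_right adjoint_works[OF \<alpha>] distrib_left)
  also have "\<dots> = (CLINT p|distr M (borel \<Otimes>\<^sub>M borel) (\<lambda>\<omega>. (?X \<omega>, - ?Y \<omega>)). ?g p)"
    unfolding joint ..
  also have "\<dots> = char_fun (distr M borel \<xi>\<^sub>1) (u - v) * char_fun (distr M borel \<xi>\<^sub>2) (u - adjoint \<alpha> v)"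
    unfolding prod
    by (subst integral_distr)
      (auto intro!: Bochner_Integration.integral_cong
        simp: exp_add exp_diff exp_minus inner_add_left inner_diff_left inner_diff_right adjoint_works[OF \<alpha>]
          distrib_left right_diff_distrib divide_inverse)
  finally show ?thesis .
qed

subsection \<open>Third differences\<close>

lemma continuous_additive_imp_linear:
  fixes g :: "'a::real_normed_vector \<Rightarrow> 'b::real_normed_vector"
  assumes cont: "continuous_on UNIV g" and add: "\<And>x y. g (x + y) = g x + g y"
  shows "linear g"
proof (rule linearI)
  fix x :: 'a and t :: real
  have g0: "g 0 = 0" using add[of 0 0] by simp
  have neg: "g (- y) = - g y" for y
    using add[of y "- y"] g0 by (simp add: minus_unique)
  have nat: "g (real n *\<^sub>R y) = real n *\<^sub>R g y" for n y
    by (induction n) (simp_all add: g0 add scaleR_add_left)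
  have int: "g (real_of_int k *\<^sub>R y) = real_of_int k *\<^sub>R g y" for k y
    by (cases k) (simp_all only: of_int_of_nat_eq of_int_minus scaleR_minus_left nat neg)
  have rat: "g (r *\<^sub>R x) - r *\<^sub>R g x = 0" if r: "r \<in> \<rat>" for r
  proof -
    obtain a b where ab: "b > 0" "r = of_int a / of_int b"
      using Rats_cases'[OF r] by metis
    have "of_int b *\<^sub>R g (r *\<^sub>R x) = g (of_int b *\<^sub>R (r *\<^sub>R x))"
      by (simp only: int)
    also have "of_int b *\<^sub>R (r *\<^sub>R x) = of_int a *\<^sub>R x"
      using ab by simp
    also have "g \<dots> = of_int a *\<^sub>R g x" by (rule int)
    also have "\<dots> = of_int b *\<^sub>R (r *\<^sub>R g x)"
      using ab by simp
    finally have "g (r *\<^sub>R x) = r *\<^sub>R g x"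
      unfolding scaleR_cancel_left using ab(1) by simp
    then show ?thesis by simp
  qed
  have "g (t *\<^sub>R x) - t *\<^sub>R g x = 0"
  proof (rule continuous_constant_on_closure[where S = "\<rat>" and f = "\<lambda>t. g (t *\<^sub>R x) - t *\<^sub>R g x"])
    show "continuous_on (closure \<rat>) (\<lambda>t. g (t *\<^sub>R x) - t *\<^sub>R g x)"
      by (intro continuous_intros continuous_on_compose2[OF cont]) auto
  qed (auto simp: rat Rats_closure_real)
  then show "g (t *\<^sub>R x) = t *\<^sub>R g x" by simp
qed (rule add)

text \<open>The values lie in the discrete set of multiples of 2 pi i and the domain is connected.
  This turns identities between exponentials into identities between continuous logarithms.\<close>

lemma continuous_exp_eq_1_imp_0:
  fixes d :: "'a::real_normed_vector \<Rightarrow> complex"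
  assumes cont: "continuous_on UNIV d" and exp: "\<And>z. exp (d z) = 1" and d0: "d 0 = 0"
  shows "d z = 0"
proof -
  have "d constant_on UNIV"
  proof (rule continuous_discrete_range_constant[OF connected_UNIV cont])
    fix x
    have "1 \<le> norm (d y - d x)" if "d y \<noteq> d x" for y
    proof -
      obtain k :: int where k: "d y = d x + (of_int (2 * k) * pi) * \<i>"
        using exp[of x] exp[of y] exp_eq[of "d y" "d x"] by auto
      then have "k \<noteq> 0" using that by auto
      have "2 * 1 * 1 \<le> \<bar>2 * real_of_int k * pi\<bar>"
        unfolding abs_mult using \<open>k \<noteq> 0\<close> pi_gt3 by (intro mult_mono) auto
      also have "\<dots> = norm (d y - d x)" using k by (simp add: norm_mult abs_mult)
      finally show ?thesis by simp
    qed
    then show "\<exists>e>0. \<forall>y. y \<in> UNIV \<and> d y \<noteq> d x \<longrightarrow> e \<le> norm (d y - d x)"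
      by (intro exI[of _ 1]) auto
  qed
  then show ?thesis using d0 by (auto simp: constant_on_def)
qed

text \<open>Each of \<open>Y\<close>, \<open>Z\<close>, \<open>W\<close> ignores one of the three
  indices, so the alternating sum over the vertices of the cube kills it.\<close>

lemma third_difference_eq_0:
  fixes P :: "'a::real_vector \<Rightarrow> 'b::ab_group_add" and Y Z W :: "real \<Rightarrow> real \<Rightarrow> 'b"
  assumes E: "\<And>i j m. i \<in> {0, 1} \<Longrightarrow> j \<in> {0, 1} \<Longrightarrow> m \<in> {0, 1} \<Longrightarrow>
    P (x + i *\<^sub>R e\<^sub>1 + j *\<^sub>R e\<^sub>2 + m *\<^sub>R e\<^sub>3) + Y i j = Z i m + W j m"
  shows "P (x + e\<^sub>1 + e\<^sub>2 + e\<^sub>3) - P (x + e\<^sub>1 + e\<^sub>2) - P (x + e\<^sub>1 + e\<^sub>3) - P (x + e\<^sub>2 + e\<^sub>3)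
    + P (x + e\<^sub>1) + P (x + e\<^sub>2) + P (x + e\<^sub>3) - P x = 0"
proof -
  have E': "P (x + i *\<^sub>R e\<^sub>1 + j *\<^sub>R e\<^sub>2 + m *\<^sub>R e\<^sub>3) = Z i m + W j m - Y i j"
    if "i \<in> {0, 1}" "j \<in> {0, 1}" "m \<in> {0, 1}" for i j m
    using E[OF that] by (simp add: eq_diff_eq)
  have "P x = Z 0 0 + W 0 0 - Y 0 0"
    "P (x + e\<^sub>3) = Z 0 1 + W 0 1 - Y 0 0"
    "P (x + e\<^sub>2) = Z 0 0 + W 1 0 - Y 0 1"
    "P (x + e\<^sub>2 + e\<^sub>3) = Z 0 1 + W 1 1 - Y 0 1"
    "P (x + e\<^sub>1) = Z 1 0 + W 0 0 - Y 1 0"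
    "P (x + e\<^sub>1 + e\<^sub>3) = Z 1 1 + W 0 1 - Y 1 0"
    "P (x + e\<^sub>1 + e\<^sub>2) = Z 1 0 + W 1 0 - Y 1 1"
    "P (x + e\<^sub>1 + e\<^sub>2 + e\<^sub>3) = Z 1 1 + W 1 1 - Y 1 1"
    using E'[of 0 0 0] E'[of 0 0 1] E'[of 0 1 0] E'[of 0 1 1]
      E'[of 1 0 0] E'[of 1 0 1] E'[of 1 1 0] E'[of 1 1 1] by simp_all
  then show ?thesis by (simp only:) (simp add: algebra_simps)
qed

lemma linear_inj_right_inverse:
  fixes f :: "'a::euclidean_space \<Rightarrow> 'a"
  assumes "linear f" "inj f"
  obtains g where "linear g" "\<And>x. f (g x) = x"
  using linear_surjective_right_inverse[OF assms(1) linear_inj_imp_surj[OF assms]]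
  by (metis comp_apply id_apply)

text \<open>In \<open>P (u + v) + Q (u + \<beta> v) = P (u - v) + Q (u - \<beta> v)\<close> the increments
  \<open>(\<beta> k, k)\<close>, \<open>(h, h)\<close> and \<open>(\<beta> l, - l)\<close> of \<open>(u, v)\<close> leave \<open>u - \<beta> v\<close>, \<open>u - v\<close> and
  \<open>u + \<beta> v\<close> respectively unchanged, so that only a third difference of \<open>P\<close> survives.\<close>

lemma heyde_third_difference:
  fixes \<beta> :: "'a::euclidean_space \<Rightarrow> 'a"
  assumes \<beta>: "linear \<beta>" and inj: "inj (\<lambda>x. x + \<beta> x)" "inj (\<lambda>x. x - \<beta> x)"
  obtains C :: real where "C > 0"
    "\<And>(P::'a \<Rightarrow> 'b::ab_group_add) Q S x r e\<^sub>1 e\<^sub>2 e\<^sub>3.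
      (\<And>u v. u + v \<in> S \<Longrightarrow> u - v \<in> S \<Longrightarrow> u + \<beta> v \<in> S \<Longrightarrow> u - \<beta> v \<in> S \<Longrightarrow>
        P (u + v) + Q (u + \<beta> v) = P (u - v) + Q (u - \<beta> v)) \<Longrightarrow>
      (\<And>z. norm z \<le> r \<Longrightarrow> x + z \<in> S) \<Longrightarrow>
      C * (norm e\<^sub>1 + norm e\<^sub>2 + norm e\<^sub>3) \<le> r \<Longrightarrow>
      P (x + e\<^sub>1 + e\<^sub>2 + e\<^sub>3) - P (x + e\<^sub>1 + e\<^sub>2) - P (x + e\<^sub>1 + e\<^sub>3) - P (x + e\<^sub>2 + e\<^sub>3)
        + P (x + e\<^sub>1) + P (x + e\<^sub>2) + P (x + e\<^sub>3) - P x = 0"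
proof -
  have lin: "linear (\<lambda>x. x + \<beta> x)" "linear (\<lambda>x. x - \<beta> x)"
    using \<beta> by (simp_all add: linear_compose_add linear_compose_sub linear_ident)
  obtain N where N: "linear N" "\<And>x. N x + \<beta> (N x) = x"
    using linear_inj_right_inverse[OF lin(1) inj(1)] by blast
  obtain M where M: "linear M" "\<And>x. M x - \<beta> (M x) = x"
    using linear_inj_right_inverse[OF lin(2) inj(2)] by blast
  have ex: "\<exists>B>0. \<forall>x. norm (f x) \<le> B * norm x" if "linear f" for f :: "'a \<Rightarrow> 'a"
    using linear_bounded_pos[OF that] by blast
  obtain B1 where B1: "B1 > 0" "\<And>x. norm (N x) \<le> B1 * norm x" using ex[OF N(1)] by blast
  obtain B2 where B2: "B2 > 0" "\<And>x. norm (M x) \<le> B2 * norm x" using ex[OF M(1)] by blast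
  obtain B3 where B3: "B3 > 0" "\<And>x. norm (\<beta> x) \<le> B3 * norm x" using ex[OF \<beta>] by blast
  obtain B4 where B4: "B4 > 0" "\<And>x. norm (\<beta> (N x)) \<le> B4 * norm x"
    using ex[OF linear_compose[OF N(1) \<beta>]] by auto
  obtain B5 where B5: "B5 > 0" "\<And>x. norm (\<beta> (M x)) \<le> B5 * norm x"
    using ex[OF linear_compose[OF M(1) \<beta>]] by auto
  \<comment> \<open>A crude common bound: the \<open>i\<close>-th increment moves each of the four
    arguments of \<open>P\<close> and \<open>Q\<close> by at most \<open>C\<close> times the norm of
    the \<open>i\<close>-th difference vector. It depends on \<open>\<beta>\<close> only.\<close>
  define C where "C = 1 + 2 * (B1 + B2 + B3 + B4 + B5)"
  note pos = B1(1) B2(1) B3(1) B4(1) B5(1)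
  have C: "C > 0" using pos by (simp add: C_def)
  have le: "norm z \<le> C * norm x" if "norm z \<le> c * norm x" "c \<le> C" for z x :: 'a and c
    using that by (meson mult_right_mono norm_ge_zero order_trans)
  note simps = linear_add[OF \<beta>] linear_diff[OF \<beta>] linear_cmul[OF \<beta>]
  show ?thesis
  proof (rule that[OF C])
    fix P Q :: "'a \<Rightarrow> 'b" and S and x e\<^sub>1 e\<^sub>2 e\<^sub>3 :: 'a and r :: real
    assume E: "\<And>u v. u + v \<in> S \<Longrightarrow> u - v \<in> S \<Longrightarrow> u + \<beta> v \<in> S \<Longrightarrow> u - \<beta> v \<in> S \<Longrightarrow>
        P (u + v) + Q (u + \<beta> v) = P (u - v) + Q (u - \<beta> v)"
      and S: "\<And>z. norm z \<le> r \<Longrightarrow> x + z \<in> S"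
      and r: "C * (norm e\<^sub>1 + norm e\<^sub>2 + norm e\<^sub>3) \<le> r"
    \<comment> \<open>Solved so that the three increments move \<open>u + v\<close> by exactly
      \<open>e\<^sub>1\<close>, \<open>e\<^sub>2\<close> and \<open>e\<^sub>3\<close>.\<close>
    define k h l where "k = N e\<^sub>1" and "h = e\<^sub>2 /\<^sub>R 2" and "l = - M e\<^sub>3"
    have k: "e\<^sub>1 = k + \<beta> k" and h: "e\<^sub>2 = h + h" and l: "e\<^sub>3 = \<beta> l - l"
      using N(2)[of e\<^sub>1] M(2)[of e\<^sub>3] by (simp_all add: k_def h_def l_def linear_neg[OF \<beta>] flip: scaleR_add_left)
    have mem: "x + (i *\<^sub>R a + j *\<^sub>R b + m *\<^sub>R c) \<in> S"
      if "norm a \<le> C * norm e\<^sub>1" "norm b \<le> C * norm e\<^sub>2" "norm c \<le> C * norm e\<^sub>3"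
        "i \<in> {0, 1}" "j \<in> {0, 1}" "m \<in> {0, 1}" for a b c and i j m :: real
    proof (rule S)
      have "norm (i *\<^sub>R a + j *\<^sub>R b + m *\<^sub>R c) \<le> norm (i *\<^sub>R a) + norm (j *\<^sub>R b) + norm (m *\<^sub>R c)"
        by (meson add_right_mono norm_triangle_ineq order_trans)
      also have "\<dots> \<le> norm a + norm b + norm c"
        using that(4-6) by auto
      also have "\<dots> \<le> r" using that(1-3) r by (simp add: distrib_left)
      finally show "norm (i *\<^sub>R a + j *\<^sub>R b + m *\<^sub>R c) \<le> r" .
    qed
    have k1: "norm (k + \<beta> k) \<le> C * norm e\<^sub>1"
      using le[of "k + \<beta> k" 1 e\<^sub>1] pos k by (simp add: C_def)
    have k2: "norm (\<beta> k - k) \<le> C * norm e\<^sub>1"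
      using norm_triangle_ineq4[of "\<beta> k" k] pos B4(2)[of e\<^sub>1] B1(2)[of e\<^sub>1]
      by (intro le[where c = "B4 + B1"]) (auto simp: k_def C_def distrib_right)
    have k3: "norm (2 *\<^sub>R \<beta> k) \<le> C * norm e\<^sub>1"
      using pos B4(2)[of e\<^sub>1]
      by (intro le[where c = "2 * B4"]) (auto simp: k_def C_def)
    have h1: "norm (h + h) \<le> C * norm e\<^sub>2"
      using le[of "h + h" 1 e\<^sub>2] pos h by (simp add: C_def)
    have bh: "norm (\<beta> h) \<le> B3 / 2 * norm e\<^sub>2"
      using B3(2)[of h] by (simp add: h_def)
    have h2: "norm (h + \<beta> h) \<le> C * norm e\<^sub>2"
      using norm_triangle_ineq[of h "\<beta> h"] pos bh
      by (intro le[where c = "1/2 + B3/2"]) (auto simp: h_def C_def distrib_right)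
    have h3: "norm (h - \<beta> h) \<le> C * norm e\<^sub>2"
      using norm_triangle_ineq4[of h "\<beta> h"] pos bh
      by (intro le[where c = "1/2 + B3/2"]) (auto simp: h_def C_def distrib_right)
    have l1: "norm (\<beta> l - l) \<le> C * norm e\<^sub>3"
      using le[of "\<beta> l - l" 1 e\<^sub>3] pos l by (simp add: C_def)
    have nl: "norm l \<le> B2 * norm e\<^sub>3" "norm (\<beta> l) \<le> B5 * norm e\<^sub>3"
      using B2(2)[of e\<^sub>3] B5(2)[of e\<^sub>3] by (simp_all add: l_def linear_neg[OF \<beta>])
    have l2: "norm (\<beta> l + l) \<le> C * norm e\<^sub>3"
      using norm_triangle_ineq[of "\<beta> l" l] pos nl
      by (intro le[where c = "B5 + B2"]) (auto simp: C_def distrib_right)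
    have l3: "norm (2 *\<^sub>R \<beta> l) \<le> C * norm e\<^sub>3"
      using pos nl
      by (intro le[where c = "2 * B5"]) (auto simp: C_def)
    have z: "norm (0::'a) \<le> C * norm e" for e :: 'a using C by simp
    show "P (x + e\<^sub>1 + e\<^sub>2 + e\<^sub>3) - P (x + e\<^sub>1 + e\<^sub>2) - P (x + e\<^sub>1 + e\<^sub>3) - P (x + e\<^sub>2 + e\<^sub>3)
        + P (x + e\<^sub>1) + P (x + e\<^sub>2) + P (x + e\<^sub>3) - P x = 0"
    proof (rule third_difference_eq_0[where
          Y = "\<lambda>i j. Q (x + (i *\<^sub>R (2 *\<^sub>R \<beta> k) + j *\<^sub>R (h + \<beta> h)))" and
          Z = "\<lambda>i m. P (x + (i *\<^sub>R (\<beta> k - k) + m *\<^sub>R (\<beta> l + l)))" and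
          W = "\<lambda>j m. Q (x + (j *\<^sub>R (h - \<beta> h) + m *\<^sub>R (2 *\<^sub>R \<beta> l)))"])
      fix i j m :: real assume ijm: "i \<in> {0, 1}" "j \<in> {0, 1}" "m \<in> {0, 1}"
      define u v where "u = x + i *\<^sub>R \<beta> k + j *\<^sub>R h + m *\<^sub>R \<beta> l" and "v = i *\<^sub>R k + j *\<^sub>R h - m *\<^sub>R l"
      have eqs: "u + v = x + (i *\<^sub>R (k + \<beta> k) + j *\<^sub>R (h + h) + m *\<^sub>R (\<beta> l - l))"
        "u + \<beta> v = x + (i *\<^sub>R (2 *\<^sub>R \<beta> k) + j *\<^sub>R (h + \<beta> h) + m *\<^sub>R 0)"
        "u - v = x + (i *\<^sub>R (\<beta> k - k) + j *\<^sub>R 0 + m *\<^sub>R (\<beta> l + l))"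
        "u - \<beta> v = x + (i *\<^sub>R 0 + j *\<^sub>R (h - \<beta> h) + m *\<^sub>R (2 *\<^sub>R \<beta> l))"
        by (simp_all add: u_def v_def simps algebra_simps scaleR_2)
      have "P (u + v) + Q (u + \<beta> v) = P (u - v) + Q (u - \<beta> v)"
        by (rule E; unfold eqs; rule mem) (use k1 k2 k3 h1 h2 h3 l1 l2 l3 z ijm in auto)
      then show "P (x + i *\<^sub>R e\<^sub>1 + j *\<^sub>R e\<^sub>2 + m *\<^sub>R e\<^sub>3) + Q (x + (i *\<^sub>R (2 *\<^sub>R \<beta> k) + j *\<^sub>R (h + \<beta> h))) =
         P (x + (i *\<^sub>R (\<beta> k - k) + m *\<^sub>R (\<beta> l + l))) + Q (x + (j *\<^sub>R (h - \<beta> h) + m *\<^sub>R (2 *\<^sub>R \<beta> l)))"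
        unfolding eqs k h l by (simp add: add.assoc)
    qed
  qed
qed

subsection \<open>The nondegenerate case\<close>

text \<open>Formulated for functions instead of measures, so that it applies to the composites of
  the characteristic functions with \<open>\<pi>\<close> and to the exchanged pair.\<close>

locale nondegenerate_heyde =
  fixes f\<^sub>1 f\<^sub>2 :: "'a::euclidean_space \<Rightarrow> complex" and \<beta> :: "'a \<Rightarrow> 'a"
  assumes linear: "linear \<beta>" and inj: "inj \<beta>" "inj (\<lambda>x. x + \<beta> x)" "inj (\<lambda>x. x - \<beta> x)"
    and cont: "continuous_on UNIV f\<^sub>1" "continuous_on UNIV f\<^sub>2"
    and one: "f\<^sub>1 0 = 1" "f\<^sub>2 0 = 1"
    and cnj: "\<And>y. f\<^sub>1 (- y) = cnj (f\<^sub>1 y)" "\<And>y. f\<^sub>2 (- y) = cnj (f\<^sub>2 y)"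
    and heyde: "\<And>u v. f\<^sub>1 (u + v) * f\<^sub>2 (u + \<beta> v) = f\<^sub>1 (u - v) * f\<^sub>2 (u - \<beta> v)"
begin

text \<open>Substituting the inverse of \<open>\<beta>\<close> applied to \<open>v\<close> for
  \<open>v\<close> exchanges the roles of the two functions. What is proved for
  \<open>f\<^sub>1\<close> thus holds for \<open>f\<^sub>2\<close>.\<close>

lemma swap:
  obtains \<beta>' where "nondegenerate_heyde f\<^sub>2 f\<^sub>1 \<beta>'"
proof -
  obtain \<gamma> where \<gamma>: "linear \<gamma>" "\<And>x. \<beta> (\<gamma> x) = x"
    using linear_inj_right_inverse[OF linear inj(1)] by blast
  have lin: "linear (\<lambda>x. x + \<gamma> x)" "linear (\<lambda>x. x - \<gamma> x)"
    using \<gamma>(1) by (simp_all add: linear_compose_add linear_compose_sub linear_ident)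
  have "nondegenerate_heyde f\<^sub>2 f\<^sub>1 \<gamma>"
  proof (rule nondegenerate_heyde.intro)
    show "inj \<gamma>" using \<gamma>(2) by (metis injI)
    show "inj (\<lambda>x. x + \<gamma> x)"
      unfolding linear_injective_0[OF lin(1)]
    proof (intro allI impI)
      fix x assume "x + \<gamma> x = 0"
      then have "\<gamma> x + \<beta> (\<gamma> x) = 0 + \<beta> 0"
        using \<gamma>(2)[of x] linear_0[OF linear] by (simp add: add.commute)
      then have "\<gamma> x = 0" using injD[OF inj(2)] by blast
      then show "x = 0" using \<gamma>(2)[of x] linear_0[OF linear] by simp
    qed
    show "inj (\<lambda>x. x - \<gamma> x)"
      unfolding linear_injective_0[OF lin(2)]
    proof (intro allI impI)
      fix x assume "x - \<gamma> x = 0"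
      then have "\<gamma> x - \<beta> (\<gamma> x) = 0 - \<beta> 0"
        using \<gamma>(2)[of x] linear_0[OF linear] by simp
      then have "\<gamma> x = 0" using injD[OF inj(3)] by blast
      then show "x = 0" using \<gamma>(2)[of x] linear_0[OF linear] by simp
    qed
    show "f\<^sub>2 (u + v) * f\<^sub>1 (u + \<gamma> v) = f\<^sub>2 (u - v) * f\<^sub>1 (u - \<gamma> v)" for u v
      using heyde[of u "\<gamma> v"] by (simp add: \<gamma>(2) mult.commute)
  qed (use \<gamma>(1) cont one cnj in auto)
  then show ?thesis by (rule that)
qed

text \<open>Along a fine grid on the segment, \<open>ln (cmod (f\<^sub>1 z))\<close> has vanishing
  third differences, is even and is 0 at 0; so it is quadratic on the grid, and doubling the
  argument multiplies it by 4. Only zeros near the segment could interfere, and compactness excludes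
  them.\<close>

lemma norm_eq_norm_half_power4:
  assumes seg: "\<And>t. 0 \<le> t \<Longrightarrow> t \<le> 1 \<Longrightarrow> f\<^sub>1 (t *\<^sub>R y) \<noteq> 0 \<and> f\<^sub>2 (t *\<^sub>R y) \<noteq> 0"
  shows "cmod (f\<^sub>1 y) = cmod (f\<^sub>1 (y /\<^sub>R 2)) ^ 4"
proof -
  define S where "S = {z. f\<^sub>1 z \<noteq> 0 \<and> f\<^sub>2 z \<noteq> 0}"
  define P where "P z = ln (cmod (f\<^sub>1 z))" for z
  define Q where "Q z = ln (cmod (f\<^sub>2 z))" for z
  obtain C where C: "C > 0" and C3:
    "\<And>(P::'a \<Rightarrow> real) Q S x r e\<^sub>1 e\<^sub>2 e\<^sub>3.
      (\<And>u v. u + v \<in> S \<Longrightarrow> u - v \<in> S \<Longrightarrow> u + \<beta> v \<in> S \<Longrightarrow> u - \<beta> v \<in> S \<Longrightarrow>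
        P (u + v) + Q (u + \<beta> v) = P (u - v) + Q (u - \<beta> v)) \<Longrightarrow>
      (\<And>z. norm z \<le> r \<Longrightarrow> x + z \<in> S) \<Longrightarrow>
      C * (norm e\<^sub>1 + norm e\<^sub>2 + norm e\<^sub>3) \<le> r \<Longrightarrow>
      P (x + e\<^sub>1 + e\<^sub>2 + e\<^sub>3) - P (x + e\<^sub>1 + e\<^sub>2) - P (x + e\<^sub>1 + e\<^sub>3) - P (x + e\<^sub>2 + e\<^sub>3)
        + P (x + e\<^sub>1) + P (x + e\<^sub>2) + P (x + e\<^sub>3) - P x = 0"
    using heyde_third_difference[OF linear inj(2,3)] by blast
  have E: "P (u + v) + Q (u + \<beta> v) = P (u - v) + Q (u - \<beta> v)"
    if "u + v \<in> S" "u - v \<in> S" "u + \<beta> v \<in> S" "u - \<beta> v \<in> S" for u v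
  proof -
    have "ln (cmod (f\<^sub>1 (u + v)) * cmod (f\<^sub>2 (u + \<beta> v))) = ln (cmod (f\<^sub>1 (u - v)) * cmod (f\<^sub>2 (u - \<beta> v)))"
      using heyde[of u v] by (simp flip: norm_mult)
    then show ?thesis
      using that by (simp add: P_def Q_def S_def ln_mult)
  qed
  have "open S"
    unfolding S_def using cont
    by (intro open_Collect_conj open_Collect_neq continuous_intros) auto
  \<comment> \<open>The segment is taken on both sides of 0 because the recurrence will start at
    \<open>- e\<close>.\<close>
  define K where "K = (\<lambda>t. t *\<^sub>R y) ` {-1..1::real}"
  have "compact K"
    unfolding K_def by (intro compact_continuous_image continuous_intros) auto
  have "K \<subseteq> S"
  proof
    fix z assume "z \<in> K"
    then obtain t where z: "z = t *\<^sub>R y" and "t \<in> {-1..1}"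
      unfolding K_def by (rule imageE)
    then have t: "z = t *\<^sub>R y" "-1 \<le> t" "t \<le> 1" by auto
    show "z \<in> S"
    proof (cases "t \<ge> 0")
      case True
      with t seg[of t] show ?thesis by (simp add: S_def)
    next
      case False
      then show ?thesis using t seg[of "- t"] cnj(1)[of "t *\<^sub>R y"] cnj(2)[of "t *\<^sub>R y"] by (auto simp: S_def)
    qed
  qed
  obtain r where r: "r > 0" "(\<Union>x\<in>K. cball x r) \<subseteq> S"
    using compact_subset_open_imp_cball_epsilon_subset[OF \<open>compact K\<close> \<open>open S\<close> \<open>K \<subseteq> S\<close>] by blast
  obtain n :: nat where n: "3 * C * norm y / r < real n"
    using reals_Archimedean2 by blast
  have "0 \<le> 3 * C * norm y / r" using C r by simp
  then have "0 < real n" using n by linarith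
  then have n0: "n > 0" by simp
  \<comment> \<open>An even number of steps puts both \<open>y\<close> and
    \<open>y /\<^sub>R 2\<close> on the grid.\<close>
  define e where "e = (1 / (2 * real n)) *\<^sub>R y"
  have "3 * C * norm y \<le> 2 * real n * r"
  proof -
    have "3 * C * norm y < real n * r" using n r(1) by (simp add: pos_divide_less_eq)
    moreover have "0 \<le> real n * r" using r(1) by simp
    ultimately show ?thesis by linarith
  qed
  then have Ce: "C * (norm e + norm e + norm e) \<le> r"
    using n0 by (simp add: e_def field_simps)
  have diff: "P ((t + 3) *\<^sub>R e) = 3 * P ((t + 2) *\<^sub>R e) - 3 * P ((t + 1) *\<^sub>R e) + P (t *\<^sub>R e)"
    if t: "-1 \<le> t" "t \<le> 2 * real n" for t
  proof -
    have "t *\<^sub>R e \<in> K"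
      unfolding K_def e_def using t n0
      by (intro image_eqI[where x = "t / (2 * real n)"]) (auto simp: field_simps)
    moreover have "t *\<^sub>R e + z \<in> cball (t *\<^sub>R e) r" if "norm z \<le> r" for z
      using that by (simp add: dist_norm)
    ultimately have mem: "t *\<^sub>R e + z \<in> S" if "norm z \<le> r" for z
      using that r(2) by blast
    have step: "s *\<^sub>R e + e = (s + 1) *\<^sub>R e" for s
      by (simp add: scaleR_add_left)
    have "t *\<^sub>R e + e = (t + 1) *\<^sub>R e" "(t + 1) *\<^sub>R e + e = (t + 2) *\<^sub>R e" "(t + 2) *\<^sub>R e + e = (t + 3) *\<^sub>R e"
      using step[of t] step[of "t + 1"] step[of "t + 2"] by (simp_all add: add.assoc)
    then show ?thesis
      using C3[of S P Q r "t *\<^sub>R e" e e e, OF E mem Ce] by simp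
  qed
  have P0: "P 0 = 0" by (simp add: P_def one)
  have "P (- e) = P e" by (simp add: P_def cnj)
  \<comment> \<open>Starting the recurrence at \<open>- e\<close> and using evenness supplies the
    missing third initial value.\<close>
  then have P2: "P (2 *\<^sub>R e) = 4 * P e"
    using diff[of "-1"] n0 P0 by simp
  have quad: "P (real i *\<^sub>R e) = (real i)\<^sup>2 * P e \<and> P (real (i + 1) *\<^sub>R e) = (real (i + 1))\<^sup>2 * P e \<and>
      P (real (i + 2) *\<^sub>R e) = (real (i + 2))\<^sup>2 * P e" if "i \<le> 2 * n" for i
    using that
  proof (induction i)
    case 0
    then show ?case using P0 P2 by (simp add: power2_eq_square)
  next
    case (Suc i)
    then have IH: "P (real i *\<^sub>R e) = (real i)\<^sup>2 * P e" "P (real (i + 1) *\<^sub>R e) = (real (i + 1))\<^sup>2 * P e"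
      "P (real (i + 2) *\<^sub>R e) = (real (i + 2))\<^sup>2 * P e" by auto
    have "real i \<le> 2 * real n" using Suc.prems by linarith
    then have "P (real (i + 3) *\<^sub>R e) = 3 * P (real (i + 2) *\<^sub>R e) - 3 * P (real (i + 1) *\<^sub>R e) + P (real i *\<^sub>R e)"
      using diff[of "real i"] by (simp add: add.commute)
    also have "\<dots> = (real (i + 3))\<^sup>2 * P e"
      unfolding IH by (simp add: power2_eq_square algebra_simps)
    finally have "P (real (i + 3) *\<^sub>R e) = (real (i + 3))\<^sup>2 * P e" .
    moreover have "Suc i = i + 1" "i + 1 + 1 = i + 2" "i + 1 + 2 = i + 3" by simp_all
    ultimately show ?case using IH by (simp only:)
  qed
  have "P y = 4 * P (y /\<^sub>R 2)"
  proof -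
    have "real (2 * n) *\<^sub>R e = y" "real n *\<^sub>R e = y /\<^sub>R 2"
      using n0 by (simp_all add: e_def)
    then show ?thesis
      using quad[of "2 * n"] quad[of n] by (simp add: power2_eq_square)
  qed
  moreover have "f\<^sub>1 y \<noteq> 0" "f\<^sub>1 (y /\<^sub>R 2) \<noteq> 0"
    using seg[of 1] seg[of "1/2"] by auto
  ultimately have "ln (cmod (f\<^sub>1 y)) = ln (cmod (f\<^sub>1 (y /\<^sub>R 2)) ^ 4)"
    by (simp add: P_def ln_realpow)
  then show ?thesis
    using \<open>f\<^sub>1 y \<noteq> 0\<close> \<open>f\<^sub>1 (y /\<^sub>R 2) \<noteq> 0\<close> by (subst (asm) ln_inj_iff) auto
qed

text \<open>At the first parameter \<open>s\<close> where one of the functions vanishes on the ray,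
  the fourth-power identity persists by continuity, so that function also vanishes at
  \<open>s / 2\<close>, contradicting minimality.\<close>

lemma nonvanishing: "f\<^sub>1 y \<noteq> 0 \<and> f\<^sub>2 y \<noteq> 0"
proof (rule ccontr)
  assume y: "\<not> (f\<^sub>1 y \<noteq> 0 \<and> f\<^sub>2 y \<noteq> 0)"
  define Z where "Z = {t \<in> {0..1}. f\<^sub>1 (t *\<^sub>R y) * f\<^sub>2 (t *\<^sub>R y) = 0}"
  have c: "continuous_on A (\<lambda>t. f\<^sub>1 ((c * t) *\<^sub>R y))" "continuous_on A (\<lambda>t. f\<^sub>2 ((c * t) *\<^sub>R y))" for A c
    by (intro continuous_intros continuous_on_compose2[OF cont(1)] continuous_on_compose2[OF cont(2)]; simp)+
  have "closed Z"
    unfolding Z_def using c[of _ 1]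
    by (intro continuous_closed_preimage_constant continuous_intros) auto
  moreover have "bounded Z"
    by (rule bounded_subset[of "{0..1}"]) (auto simp: Z_def)
  ultimately have "compact Z" by (simp add: compact_eq_bounded_closed)
  moreover have "1 \<in> Z" using y by (auto simp: Z_def)
  ultimately obtain s where s: "s \<in> Z" "\<And>t. t \<in> Z \<Longrightarrow> s \<le> t"
    using compact_attains_inf[of Z] by blast
  have "0 \<notin> Z" by (simp add: Z_def one)
  then have s0: "0 < s" "s \<le> 1" using s(1) by (auto simp: Z_def less_le)
  have nz: "f\<^sub>1 (t *\<^sub>R y) \<noteq> 0 \<and> f\<^sub>2 (t *\<^sub>R y) \<noteq> 0" if "0 \<le> t" "t < s" for t
    using s(2)[of t] that s0 by (fastforce simp: Z_def)
  obtain \<beta>' where "nondegenerate_heyde f\<^sub>2 f\<^sub>1 \<beta>'" by (rule swap)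
  then interpret sw: nondegenerate_heyde f\<^sub>2 f\<^sub>1 \<beta>' .
  have seg: "f\<^sub>1 (t' *\<^sub>R t *\<^sub>R y) \<noteq> 0 \<and> f\<^sub>2 (t' *\<^sub>R t *\<^sub>R y) \<noteq> 0"
    if "0 \<le> t" "t < s" "0 \<le> t'" "t' \<le> 1" for t t'
    using nz[of "t' * t"] that mult_left_le_one_le[of t t'] by auto
  have cl: "s \<in> closure {0..<s}" using s0 by simp
  have "cmod (f\<^sub>1 ((1 * s) *\<^sub>R y)) - cmod (f\<^sub>1 ((1/2 * s) *\<^sub>R y)) ^ 4 = 0"
  proof (rule continuous_constant_on_closure[OF _ _ cl])
    show "continuous_on (closure {0..<s}) (\<lambda>s. cmod (f\<^sub>1 ((1 * s) *\<^sub>R y)) - cmod (f\<^sub>1 ((1/2 * s) *\<^sub>R y)) ^ 4)"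
      by (intro continuous_intros c)
    show "cmod (f\<^sub>1 ((1 * t) *\<^sub>R y)) - cmod (f\<^sub>1 ((1/2 * t) *\<^sub>R y)) ^ 4 = 0" if "t \<in> {0..<s}" for t
      using norm_eq_norm_half_power4[of "t *\<^sub>R y", OF seg] that by simp
  qed
  moreover have "cmod (f\<^sub>2 ((1 * s) *\<^sub>R y)) - cmod (f\<^sub>2 ((1/2 * s) *\<^sub>R y)) ^ 4 = 0"
  proof (rule continuous_constant_on_closure[OF _ _ cl])
    show "continuous_on (closure {0..<s}) (\<lambda>s. cmod (f\<^sub>2 ((1 * s) *\<^sub>R y)) - cmod (f\<^sub>2 ((1/2 * s) *\<^sub>R y)) ^ 4)"
      by (intro continuous_intros c)
    show "cmod (f\<^sub>2 ((1 * t) *\<^sub>R y)) - cmod (f\<^sub>2 ((1/2 * t) *\<^sub>R y)) ^ 4 = 0" if "t \<in> {0..<s}" for t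
      using sw.norm_eq_norm_half_power4[of "t *\<^sub>R y"] seg that by simp
  qed
  moreover have "f\<^sub>1 (s *\<^sub>R y) = 0 \<or> f\<^sub>2 (s *\<^sub>R y) = 0"
    using s(1) by (simp add: Z_def)
  ultimately show False
    using nz[of "1/2 * s"] s0 by auto
qed

text \<open>Without zeros, both functions have continuous logarithms on the contractible space. The
  functional equation and the conjugation symmetry pass to the logarithms because their defects are
  continuous, vanish at 0 and have exponential 1.\<close>

lemma log_third_difference:
  obtains \<phi> where "continuous_on UNIV \<phi>" "\<And>y. f\<^sub>1 y = exp (\<phi> y)" "\<phi> 0 = 0" "\<And>y. \<phi> (- y) = cnj (\<phi> y)"
    "\<And>x e\<^sub>1 e\<^sub>2 e\<^sub>3. \<phi> (x + e\<^sub>1 + e\<^sub>2 + e\<^sub>3) - \<phi> (x + e\<^sub>1 + e\<^sub>2) - \<phi> (x + e\<^sub>1 + e\<^sub>3) - \<phi> (x + e\<^sub>2 + e\<^sub>3)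
        + \<phi> (x + e\<^sub>1) + \<phi> (x + e\<^sub>2) + \<phi> (x + e\<^sub>3) - \<phi> x = 0"
proof -
  have log: "\<exists>\<phi>. continuous_on UNIV \<phi> \<and> (\<forall>y. f y = exp (\<phi> y)) \<and> \<phi> 0 = 0"
    if f: "continuous_on UNIV f" "\<And>y. f y \<noteq> 0" "f 0 = 1" for f :: "'a \<Rightarrow> complex"
  proof -
    obtain g where g: "continuous_on UNIV g" "\<And>y. f y = exp (g y)"
      using continuous_logarithm_on_contractible[OF f(1) contractible_UNIV] f(2) by auto
    then have "f y = exp (g y - g 0)" for y
      using f(3) by (simp add: exp_diff)
    then show ?thesis
      using g(1) by (intro exI[of _ "\<lambda>y. g y - g 0"]) (auto intro!: continuous_intros)
  qed
  obtain \<phi> where \<phi>: "continuous_on UNIV \<phi>" "\<And>y. f\<^sub>1 y = exp (\<phi> y)" "\<phi> 0 = 0"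
    using log[OF cont(1)] nonvanishing one by blast
  obtain \<psi> where \<psi>: "continuous_on UNIV \<psi>" "\<And>y. f\<^sub>2 y = exp (\<psi> y)" "\<psi> 0 = 0"
    using log[OF cont(2)] nonvanishing one by blast
  have "\<phi> (- y) - cnj (\<phi> y) = 0" for y
  proof (rule continuous_exp_eq_1_imp_0[where d = "\<lambda>y. \<phi> (- y) - cnj (\<phi> y)"])
    show "continuous_on UNIV (\<lambda>y. \<phi> (- y) - cnj (\<phi> y))"
      by (intro continuous_intros continuous_on_compose2[OF \<phi>(1)] \<phi>(1)) auto
    show "exp (\<phi> (- y) - cnj (\<phi> y)) = 1" for y
      using cnj(1)[of y] by (simp add: exp_diff \<phi>(2) exp_cnj)
  qed (simp add: \<phi>(3))
  then have sym: "\<phi> (- y) = cnj (\<phi> y)" for y by simp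
  have c\<beta>: "continuous_on UNIV \<beta>"
    using linear by (simp add: linear_continuous_on linear_conv_bounded_linear)
  define d where "d z = \<phi> (fst z + snd z) + \<psi> (fst z + \<beta> (snd z)) - (\<phi> (fst z - snd z) + \<psi> (fst z - \<beta> (snd z)))" for z
  have "d z = 0" for z
  proof (rule continuous_exp_eq_1_imp_0[where d = d])
    show "continuous_on UNIV d"
      unfolding d_def by (intro continuous_intros continuous_on_compose2[OF \<phi>(1)]
          continuous_on_compose2[OF \<psi>(1)] continuous_on_compose2[OF c\<beta>]) auto
    show "exp (d z) = 1" for z
      using heyde[of "fst z" "snd z"] by (simp add: d_def exp_diff exp_add \<phi>(2) \<psi>(2))
  qed (simp add: d_def linear_0[OF linear])
  from this[of "(u, v)" for u v]
  have E: "\<phi> (u + v) + \<psi> (u + \<beta> v) = \<phi> (u - v) + \<psi> (u - \<beta> v)" for u v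
    by (simp add: d_def)
  obtain C where "C > 0" and C3:
    "\<And>(P::'a \<Rightarrow> complex) Q S x r e\<^sub>1 e\<^sub>2 e\<^sub>3.
      (\<And>u v. u + v \<in> S \<Longrightarrow> u - v \<in> S \<Longrightarrow> u + \<beta> v \<in> S \<Longrightarrow> u - \<beta> v \<in> S \<Longrightarrow>
        P (u + v) + Q (u + \<beta> v) = P (u - v) + Q (u - \<beta> v)) \<Longrightarrow>
      (\<And>z. norm z \<le> r \<Longrightarrow> x + z \<in> S) \<Longrightarrow>
      C * (norm e\<^sub>1 + norm e\<^sub>2 + norm e\<^sub>3) \<le> r \<Longrightarrow>
      P (x + e\<^sub>1 + e\<^sub>2 + e\<^sub>3) - P (x + e\<^sub>1 + e\<^sub>2) - P (x + e\<^sub>1 + e\<^sub>3) - P (x + e\<^sub>2 + e\<^sub>3)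
        + P (x + e\<^sub>1) + P (x + e\<^sub>2) + P (x + e\<^sub>3) - P x = 0"
    using heyde_third_difference[OF linear inj(2,3)] by blast
  have D: "\<phi> (x + e\<^sub>1 + e\<^sub>2 + e\<^sub>3) - \<phi> (x + e\<^sub>1 + e\<^sub>2) - \<phi> (x + e\<^sub>1 + e\<^sub>3) - \<phi> (x + e\<^sub>2 + e\<^sub>3)
        + \<phi> (x + e\<^sub>1) + \<phi> (x + e\<^sub>2) + \<phi> (x + e\<^sub>3) - \<phi> x = 0" for x e\<^sub>1 e\<^sub>2 e\<^sub>3
    by (rule C3[where S = UNIV and Q = \<psi> and r = "C * (norm e\<^sub>1 + norm e\<^sub>2 + norm e\<^sub>3)"])
      (rule E UNIV_I order_refl)+
  show ?thesis
    by (rule that[of \<phi>]) (fact \<phi> sym D)+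
qed

end

text \<open>The real part \<open>\<rho>\<close> is even and the imaginary part
  \<open>\<theta>\<close> is odd. Vanishing third differences make \<open>\<theta>\<close> additive
  and the second difference \<open>B\<close> of \<open>\<rho>\<close> additive in each variable;
  continuity gives linearity.\<close>

lemma quadratic_of_third_difference:
  fixes \<phi> :: "real^'n \<Rightarrow> complex"
  assumes cont: "continuous_on UNIV \<phi>" and zero: "\<phi> 0 = 0" and cnj: "\<And>y. \<phi> (- y) = cnj (\<phi> y)"
    and diff: "\<And>x e\<^sub>1 e\<^sub>2 e\<^sub>3. \<phi> (x + e\<^sub>1 + e\<^sub>2 + e\<^sub>3) - \<phi> (x + e\<^sub>1 + e\<^sub>2) - \<phi> (x + e\<^sub>1 + e\<^sub>3) - \<phi> (x + e\<^sub>2 + e\<^sub>3)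
        + \<phi> (x + e\<^sub>1) + \<phi> (x + e\<^sub>2) + \<phi> (x + e\<^sub>3) - \<phi> x = 0"
  obtains A b where "transpose A = A"
    "\<And>y. \<phi> y = - complex_of_real ((A *v y) \<bullet> y) + \<i> * complex_of_real (b \<bullet> y)"
proof -
  define \<rho> where "\<rho> y = Re (\<phi> y)" for y
  define \<theta> where "\<theta> y = Im (\<phi> y)" for y
  define B where "B h k = \<rho> (h + k) - \<rho> h - \<rho> k" for h k
  have d\<rho>: "\<rho> (h + k + l) - \<rho> (h + k) - \<rho> (h + l) - \<rho> (k + l) + \<rho> h + \<rho> k + \<rho> l = 0" for h k l
    using arg_cong[OF diff[of 0 h k l], of Re] zero by (simp add: \<rho>_def)
  have d\<theta>: "\<theta> (h + k + l) - \<theta> (h + k) - \<theta> (h + l) - \<theta> (k + l) + \<theta> h + \<theta> k + \<theta> l = 0" for h k l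
    using arg_cong[OF diff[of 0 h k l], of Im] zero by (simp add: \<theta>_def)
  have even: "\<rho> (- y) = \<rho> y" and odd: "\<theta> (- y) = - \<theta> y" and z: "\<rho> 0 = 0" "\<theta> 0 = 0" for y
    using cnj[of y] zero by (simp_all add: \<rho>_def \<theta>_def)
  have c: "continuous_on UNIV \<rho>" "continuous_on UNIV \<theta>"
    unfolding \<rho>_def \<theta>_def using cont by (auto intro!: continuous_intros)
  have "linear \<theta>"
  proof (rule continuous_additive_imp_linear[OF c(2)])
    show "\<theta> (h + k) = \<theta> h + \<theta> k" for h k
      \<comment> \<open>With three increments of sum 0, oddness reduces the third difference to
        twice the defect of additivity.\<close>
      using d\<theta>[of h k "- h - k"] odd[of "h + k"] odd[of h] odd[of k] z by (simp add: algebra_simps)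
  qed
  then have b: "\<theta> y = adjoint \<theta> 1 \<bullet> y" for y
    using adjoint_works[of \<theta> y 1] by (simp add: inner_commute)
  have sym: "B h k = B k h" for h k by (simp add: B_def add.commute)
  have linB: "linear (B h)" for h
  proof (rule continuous_additive_imp_linear)
    show "continuous_on UNIV (B h)"
      unfolding B_def by (intro continuous_intros continuous_on_compose2[OF c(1)]) auto
    show "B h (k + l) = B h k + B h l" for k l
      using d\<rho>[of h k l] by (simp add: B_def algebra_simps)
  qed
  have \<rho>B: "\<rho> h = B h h / 2" for h
  proof -
    have "B h (- h) = - B h h" using linear_neg[OF linB] .
    then show ?thesis using even[of h] z by (simp add: B_def)
  qed
  define L where "L h = adjoint (B h) 1" for h
  have L: "B h k = L h \<bullet> k" for h k
    using adjoint_works[OF linB, of k h 1] by (simp add: L_def inner_commute)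
  have "linear L"
  proof (rule linearI)
    fix h h' :: "real^'n" and r :: real
    have "L (h + h') \<bullet> k = (L h + L h') \<bullet> k" for k
      using linear_add[OF linB, of k h h'] by (simp add: inner_add_left flip: L) (simp add: sym)
    then show "L (h + h') = L h + L h'"
      by (metis vector_eq_rdot)
    have "L (r *\<^sub>R h) \<bullet> k = (r *\<^sub>R L h) \<bullet> k" for k
      using linear_cmul[OF linB, of k r h] by (simp flip: L) (simp add: sym)
    then show "L (r *\<^sub>R h) = r *\<^sub>R L h"
      by (metis vector_eq_rdot)
  qed
  \<comment> \<open>The factor makes
    \<open>T h \<bullet> h = - B h h / 2 = - \<rho> h\<close>.\<close>
  define T where "T h = (- 1 / 2) *\<^sub>R L h" for h
  have T: "linear T"
    unfolding T_def by (rule linear_compose_scale_right[OF \<open>linear L\<close>])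
  have "adjoint T = T"
    using sym by (intro adjoint_unique) (simp add: T_def L inner_commute)
  then have "transpose (matrix T) = matrix T"
    using matrix_adjoint[OF T] by simp
  moreover have mT: "matrix T *v y = T y" for y
    using matrix_works[of T y] T by (simp add: linear_matrix_vector_mul_eq)
  have "\<phi> y = - complex_of_real ((matrix T *v y) \<bullet> y) + \<i> * complex_of_real (adjoint \<theta> 1 \<bullet> y)" for y
    using \<rho>B[of y] b[of y] by (simp add: complex_eq_iff mT T_def L \<rho>_def \<theta>_def)
  ultimately show ?thesis by (rule that)
qed

text \<open>The bound on the modulus enters only for positivity: the modulus at \<open>y\<close> is
  \<open>exp (- ((A *v y) \<bullet> y))\<close>.\<close>

theorem nondegenerate_heyde_gaussian:
  fixes f\<^sub>1 f\<^sub>2 :: "real^'n \<Rightarrow> complex"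
  assumes "nondegenerate_heyde f\<^sub>1 f\<^sub>2 \<beta>" and le: "\<And>y. cmod (f\<^sub>1 y) \<le> 1"
  obtains A b where "transpose A = A" "\<And>y. 0 \<le> (A *v y) \<bullet> y"
    "\<And>y. f\<^sub>1 y = exp (- complex_of_real ((A *v y) \<bullet> y) + \<i> * complex_of_real (b \<bullet> y))"
proof -
  interpret nondegenerate_heyde f\<^sub>1 f\<^sub>2 \<beta> by fact
  show ?thesis
  proof (rule log_third_difference)
    fix \<phi>
    assume \<phi>: "continuous_on UNIV \<phi>" "\<And>y. f\<^sub>1 y = exp (\<phi> y)" "\<phi> 0 = 0" "\<And>y. \<phi> (- y) = cnj (\<phi> y)"
      "\<And>x e\<^sub>1 e\<^sub>2 e\<^sub>3. \<phi> (x + e\<^sub>1 + e\<^sub>2 + e\<^sub>3) - \<phi> (x + e\<^sub>1 + e\<^sub>2) - \<phi> (x + e\<^sub>1 + e\<^sub>3) - \<phi> (x + e\<^sub>2 + e\<^sub>3)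
        + \<phi> (x + e\<^sub>1) + \<phi> (x + e\<^sub>2) + \<phi> (x + e\<^sub>3) - \<phi> x = 0"
    show ?thesis
    proof (rule quadratic_of_third_difference[OF \<phi>(1,3,4,5)])
      fix A b
      assume A: "transpose A = A"
        "\<And>y. \<phi> y = - complex_of_real ((A *v y) \<bullet> y) + \<i> * complex_of_real (b \<bullet> y)"
      have f: "f\<^sub>1 y = exp (- complex_of_real ((A *v y) \<bullet> y) + \<i> * complex_of_real (b \<bullet> y))" for y
        unfolding \<phi>(2) A(2) ..
      have "0 \<le> (A *v y) \<bullet> y" for y
        using le[of y] unfolding f norm_exp_eq_Re by simp
      with A(1) show ?thesis by (rule that[OF _ _ f])
    qed
  qed
qed

subsection \<open>Unimodularity on generalised eigenspaces\<close>

locale heyde_distributions =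
  fixes \<mu>\<^sub>1 \<mu>\<^sub>2 :: "(real^'n) measure" and \<beta> :: "real^'n \<Rightarrow> real^'n"
    and f\<^sub>1 f\<^sub>2 :: "real^'n \<Rightarrow> complex" and N T :: "real^'n \<Rightarrow> real^'n"
  defines "f\<^sub>1 \<equiv> char_fun \<mu>\<^sub>1" and "f\<^sub>2 \<equiv> char_fun \<mu>\<^sub>2"
    and "N \<equiv> \<lambda>x. x + \<beta> x" and "T \<equiv> \<lambda>x. x - \<beta> (\<beta> x)"
  assumes dist: "is_distribution \<mu>\<^sub>1" "is_distribution \<mu>\<^sub>2"
    and linear_\<beta>: "linear \<beta>" and inj_\<beta>: "inj \<beta>"
    and heyde: "\<And>u v. f\<^sub>1 (u + v) * f\<^sub>2 (u + \<beta> v) = f\<^sub>1 (u - v) * f\<^sub>2 (u - \<beta> v)"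
begin

lemma f_0: "f\<^sub>1 0 = 1" "f\<^sub>2 0 = 1"
  by (simp_all add: f\<^sub>1_def f\<^sub>2_def char_fun_0 dist)

lemma f_le: "cmod (f\<^sub>1 y) \<le> 1" "cmod (f\<^sub>2 y) \<le> 1"
  by (simp_all add: f\<^sub>1_def f\<^sub>2_def cmod_char_fun_le_1 dist)

lemma f_cnj: "f\<^sub>1 (- y) = cnj (f\<^sub>1 y)" "f\<^sub>2 (- y) = cnj (f\<^sub>2 y)"
  by (simp_all add: f\<^sub>1_def f\<^sub>2_def char_fun_uminus)

lemma f_cont: "continuous_on UNIV f\<^sub>1" "continuous_on UNIV f\<^sub>2"
  by (simp_all add: f\<^sub>1_def f\<^sub>2_def continuous_on_char_fun dist)

lemma f_shift:
  "cmod (f\<^sub>1 w) = 1 \<Longrightarrow> f\<^sub>1 (y + w) = f\<^sub>1 y * f\<^sub>1 w"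
  "cmod (f\<^sub>2 w) = 1 \<Longrightarrow> f\<^sub>2 (y + w) = f\<^sub>2 y * f\<^sub>2 w"
  by (simp_all add: f\<^sub>1_def f\<^sub>2_def char_fun_add_unimodular dist)

lemma linear_N: "linear N" and linear_T: "linear T"
  unfolding N_def T_def using linear_\<beta>
  by (auto intro!: linear_compose_add linear_compose_sub linear_ident linear_compose[of \<beta> \<beta>, unfolded comp_def])

text \<open>The functional equation in the variables \<open>a = u + v\<close> and
  \<open>c = u - v\<close>; the operator then occurs only through \<open>N\<close>, whose values can
  be placed in subspaces where the functions are known.\<close>

lemma heyde_N: "f\<^sub>1 a * f\<^sub>2 (c + N (a - c) /\<^sub>R 2) = f\<^sub>1 c * f\<^sub>2 (a - N (a - c) /\<^sub>R 2)"
proof -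
  let ?u = "(a + c) /\<^sub>R 2" and ?v = "(a - c) /\<^sub>R 2"
  have half: "x /\<^sub>R 2 + x /\<^sub>R 2 = x" for x :: "real^'n"
    by (simp flip: scaleR_add_left)
  have "?u + ?v = a" "?u - ?v = c"
    using half[of a] half[of c] by (simp_all add: algebra_simps)
  moreover have "?u + \<beta> ?v = c + N (a - c) /\<^sub>R 2"
    using half[of c] by (simp add: N_def linear_cmul[OF linear_\<beta>] linear_diff[OF linear_\<beta>] algebra_simps)
  moreover have "?u - \<beta> ?v = a - N (a - c) /\<^sub>R 2"
    using half[of a] by (simp add: N_def linear_cmul[OF linear_\<beta>] linear_diff[OF linear_\<beta>] algebra_simps)
  ultimately show ?thesis
    using heyde[of ?u ?v] by (simp only:)
qed

text \<open>For \<open>u = v\<close> the equation reads \<open>f\<^sub>1 (2 *\<^sub>R v) * f\<^sub>2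
  (v + \<beta> v) = f\<^sub>2 (v - \<beta> v)\<close>. Two factors of modulus at most 1 with a
  product of modulus 1 are both unimodular, and \<open>2 *\<^sub>R v\<close> is the sum of
  \<open>v + \<beta> v\<close> and \<open>v - \<beta> v\<close>.\<close>

lemma unimodular_minus_step:
  assumes "cmod (f\<^sub>2 (v - \<beta> v)) = 1"
  shows "cmod (f\<^sub>1 (2 *\<^sub>R v)) = 1 \<and> cmod (f\<^sub>2 (2 *\<^sub>R v)) = 1"
proof -
  have "f\<^sub>1 (2 *\<^sub>R v) * f\<^sub>2 (v + \<beta> v) = f\<^sub>2 (v - \<beta> v)"
    using heyde[of v v] f_0 by (simp add: scaleR_2)
  then have prod: "cmod (f\<^sub>1 (2 *\<^sub>R v)) * cmod (f\<^sub>2 (v + \<beta> v)) = 1"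
    using assms by (simp flip: norm_mult)
  have 1: "cmod (f\<^sub>1 (2 *\<^sub>R v)) = 1"
    using prod f_le(1)[of "2 *\<^sub>R v"] mult_left_le[OF f_le(2)[of "v + \<beta> v"], of "cmod (f\<^sub>1 (2 *\<^sub>R v))"] by simp
  then have 2: "cmod (f\<^sub>2 (v + \<beta> v)) = 1" using prod by simp
  have "2 *\<^sub>R v = (v + \<beta> v) + (v - \<beta> v)" by (simp add: scaleR_2)
  then have "cmod (f\<^sub>2 (2 *\<^sub>R v)) = 1"
    using f_shift(2)[OF assms, of "v + \<beta> v"] 2 assms by (simp add: norm_mult)
  with 1 show ?thesis by blast
qed

lemma unimodular_double:
  assumes "cmod (f\<^sub>1 y) = 1 \<and> cmod (f\<^sub>2 y) = 1"
  shows "cmod (f\<^sub>1 ((2 ^ m) *\<^sub>R y)) = 1 \<and> cmod (f\<^sub>2 ((2 ^ m) *\<^sub>R y)) = 1"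
proof (induction m)
  case (Suc m)
  have "(2 ^ Suc m) *\<^sub>R y = (2 ^ m) *\<^sub>R y + (2 ^ m) *\<^sub>R y"
    by (simp flip: scaleR_add_left)
  then show ?case using Suc f_shift[of "(2 ^ m) *\<^sub>R y" "(2 ^ m) *\<^sub>R y"] by (simp add: norm_mult)
qed (simp add: assms)

text \<open>Shifts by \<open>Z\<close> do not change the modulus of \<open>f\<^sub>2\<close>.
  Comparing the equation at \<open>a = N c\<close> and at \<open>a = 0\<close>, both with
  \<open>b = - (2 *\<^sub>R c)\<close>, gives \<open>|f\<^sub>2 (N c)|^2 = 1\<close> after
  cancelling \<open>f\<^sub>1 b\<close>.\<close>

lemma unimodular_plus_step:
  assumes Z: "subspace Z" "\<And>z. z \<in> Z \<Longrightarrow> cmod (f\<^sub>1 z) = 1 \<and> cmod (f\<^sub>2 z) = 1"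
    and c: "N (N c) \<in> Z"
  shows "cmod (f\<^sub>1 (N c)) = 1 \<and> cmod (f\<^sub>2 (N c)) = 1"
proof -
  have shift: "cmod (f\<^sub>2 (y + z)) = cmod (f\<^sub>2 y)" if "z \<in> Z" for y z
    using f_shift(2)[of z y] Z(2)[OF that] by (simp add: norm_mult)
  have star: "cmod (f\<^sub>1 a) * cmod (f\<^sub>2 (b - N b /\<^sub>R 2)) = cmod (f\<^sub>1 b) * cmod (f\<^sub>2 (a + N b /\<^sub>R 2))"
    if a: "N a \<in> Z" for a b
  proof -
    have z: "N a /\<^sub>R 2 \<in> Z" "- (N a /\<^sub>R 2) \<in> Z"
      using a Z(1) by (auto intro!: subspace_scale subspace_neg)
    have eqs: "b + N (a - b) /\<^sub>R 2 = (b - N b /\<^sub>R 2) + N a /\<^sub>R 2"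
      "a - N (a - b) /\<^sub>R 2 = (a + N b /\<^sub>R 2) + - (N a /\<^sub>R 2)"
      by (simp_all add: linear_diff[OF linear_N] algebra_simps)
    show ?thesis
      using arg_cong[OF heyde_N[of a b], of cmod]
      unfolding eqs norm_mult shift[OF z(1)] shift[OF z(2)] .
  qed
  have small: "cmod (f\<^sub>1 (N c)) = 1 \<and> cmod (f\<^sub>2 (N c)) = 1"
    if c: "N (N c) \<in> Z" and nz: "f\<^sub>1 (- (2 *\<^sub>R c)) \<noteq> 0" for c
  proof -
    let ?b = "- (2 *\<^sub>R c)"
    have Nb: "N ?b /\<^sub>R 2 = - N c"
      by (simp add: linear_neg[OF linear_N] linear_cmul[OF linear_N])
    have "N 0 \<in> Z" using Z(1) by (simp add: linear_0[OF linear_N] subspace_0)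
    then have eq: "cmod (f\<^sub>1 (N c)) = cmod (f\<^sub>2 (N c))"
      using star[OF c, of 0] by (simp add: f_0 linear_0[OF linear_N])
    have "cmod (f\<^sub>1 (N c)) * cmod (f\<^sub>2 (?b + N c)) = cmod (f\<^sub>1 ?b)"
      using star[OF c, of ?b] unfolding Nb by (simp add: f_0)
    moreover have "cmod (f\<^sub>2 (?b + N c)) = cmod (f\<^sub>1 ?b) * cmod (f\<^sub>2 (N c))"
      using star[OF \<open>N 0 \<in> Z\<close>, of ?b] unfolding Nb by (simp add: f_0 f_cnj)
    ultimately have "cmod (f\<^sub>2 (N c)) * cmod (f\<^sub>2 (N c)) * cmod (f\<^sub>1 ?b) = 1 * cmod (f\<^sub>1 ?b)"
      using eq by (simp add: mult_ac)
    then have "cmod (f\<^sub>2 (N c)) * cmod (f\<^sub>2 (N c)) = 1"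
      unfolding mult_cancel_right using nz by simp
    then have "cmod (f\<^sub>2 (N c)) = 1"
      by (metis norm_ge_zero power2_eq_square power2_eq_iff_nonneg one_power2 zero_le_one mult_1)
    with eq show ?thesis by simp
  qed
  \<comment> \<open>The cancelled value is nonzero once \<open>c\<close> is scaled down enough. The
    hypothesis on \<open>c\<close> is invariant under scaling, and \<open>unimodular_double\<close>
    undoes it.\<close>
  have "isCont f\<^sub>1 0" using f_cont(1) by (simp add: continuous_on_eq_continuous_at)
  moreover have "(\<lambda>m. (1 / 2) ^ m *\<^sub>R (- (2 *\<^sub>R c))) \<longlonglongrightarrow> 0 *\<^sub>R (- (2 *\<^sub>R c))"
    by (intro tendsto_intros LIMSEQ_realpow_zero) auto
  ultimately have "(\<lambda>m. f\<^sub>1 ((1 / 2) ^ m *\<^sub>R (- (2 *\<^sub>R c)))) \<longlonglongrightarrow> f\<^sub>1 0"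
    by (intro isCont_tendsto_compose[of _ f\<^sub>1]) auto
  then have "\<forall>\<^sub>F m in sequentially. f\<^sub>1 ((1 / 2) ^ m *\<^sub>R (- (2 *\<^sub>R c))) \<noteq> 0"
    by (rule tendsto_imp_eventually_ne) (simp add: f_0)
  then obtain m where m: "f\<^sub>1 ((1 / 2) ^ m *\<^sub>R (- (2 *\<^sub>R c))) \<noteq> 0"
    by (meson eventually_sequentially order_refl)
  let ?c = "(1 / 2) ^ m *\<^sub>R c"
  have "cmod (f\<^sub>1 (N ?c)) = 1 \<and> cmod (f\<^sub>2 (N ?c)) = 1"
  proof (rule small)
    show "N (N ?c) \<in> Z" using c Z(1) by (simp add: linear_cmul[OF linear_N] subspace_scale)
    show "f\<^sub>1 (- (2 *\<^sub>R ?c)) \<noteq> 0" using m by (simp add: mult.commute)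
  qed
  moreover have "(2 ^ m) *\<^sub>R N ?c = N c"
    by (simp add: linear_cmul[OF linear_N] power_one_over)
  ultimately show ?thesis
    using unimodular_double[of "N ?c" m] by simp
qed

text \<open>Induction on \<open>m\<close>, using the factorisation of \<open>T\<close> into
  \<open>I + \<beta>\<close> and \<open>I - \<beta>\<close>: the minus step passes from the
  induction hypothesis to an intermediate space \<open>Z\<close>, and the plus step from
  \<open>Z\<close> to \<open>w\<close>.\<close>

lemma unimodular_ker_power:
  assumes "w \<in> range N" "(T ^^ m) w = 0"
  shows "cmod (f\<^sub>1 w) = 1 \<and> cmod (f\<^sub>2 w) = 1"
  using assms
proof (induction m arbitrary: w)
  case 0
  then show ?case by (simp add: f_0)
next
  case (Suc m)
  have subW: "subspace (range N)" by (rule linear_subspace_image[OF linear_N subspace_UNIV])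
  \<comment> \<open>These are the vectors that \<open>I - \<beta>\<close> maps into the set covered
    by the induction hypothesis.\<close>
  define Z where "Z = {a \<in> range N. (T ^^ m) (a - \<beta> a) = 0 \<and> a - \<beta> a \<in> range N}"
  have lin: "linear (T ^^ m)" by (rule linear_funpow[OF linear_T])
  have "subspace Z"
  proof -
    have l: "linear (\<lambda>a. a - \<beta> a)"
      using linear_\<beta> by (intro linear_compose_sub linear_ident)
    have "Z = range N \<inter> {a. (T ^^ m) (a - \<beta> a) = 0} \<inter> (\<lambda>a. a - \<beta> a) -` range N"
      by (auto simp: Z_def)
    then show ?thesis
      using subW subspace_ker[OF linear_compose[OF l lin]] linear_subspace_vimage[OF l subW] by (simp add: subspace_inter)
  qed
  moreover have "cmod (f\<^sub>1 z) = 1 \<and> cmod (f\<^sub>2 z) = 1" if "z \<in> Z" for z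
  proof -
    have "z /\<^sub>R 2 \<in> Z" using \<open>subspace Z\<close> that by (simp add: subspace_scale)
    then have "cmod (f\<^sub>2 (z /\<^sub>R 2 - \<beta> (z /\<^sub>R 2))) = 1"
      using Suc.IH unfolding Z_def by blast
    then show ?thesis using unimodular_minus_step[of "z /\<^sub>R 2"] by simp
  qed
  moreover obtain c where c: "w = N c" using Suc.prems(1) by blast
  moreover have "N (N c) \<in> Z"
  proof -
    have eq: "N w - \<beta> (N w) = T w"
      by (simp add: N_def T_def linear_add[OF linear_\<beta>])
    have "T w = N (w - \<beta> w)"
      by (simp add: N_def T_def linear_diff[OF linear_\<beta>])
    moreover have "(T ^^ m) (T w) = 0" using Suc.prems(2) by (simp add: funpow_swap1)
    ultimately show ?thesis using eq c by (auto simp: Z_def)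
  qed
  ultimately show ?case using unimodular_plus_step by blast
qed

end

subsection \<open>Splitting along the Fitting decomposition\<close>

locale heyde_fitting = heyde_distributions +
  fixes \<pi> :: "real^'n \<Rightarrow> real^'n" and m :: nat
  assumes linear_\<pi>: "linear \<pi>" and idem: "\<And>y. \<pi> (\<pi> y) = \<pi> y"
    and T_\<pi>: "\<And>y. T (\<pi> y) = 0 \<Longrightarrow> \<pi> y = 0" and ker_\<pi>: "\<And>y. \<pi> y = 0 \<Longrightarrow> (T ^^ m) y = 0"
    and comm: "\<And>y. \<beta> (\<pi> y) = \<pi> (\<beta> y)"
begin

definition F :: "(real^'n) set" where "F = {w \<in> range N. \<pi> w = 0}"

lemma subspace_F: "subspace F"
proof -
  have "F = range N \<inter> {w. \<pi> w = 0}" by (auto simp: F_def)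
  then show ?thesis
    using linear_subspace_image[OF linear_N subspace_UNIV] subspace_ker[OF linear_\<pi>]
    by (simp add: subspace_inter)
qed

lemma unimodular_F: "w \<in> F \<Longrightarrow> cmod (f\<^sub>1 w) = 1 \<and> cmod (f\<^sub>2 w) = 1"
  unfolding F_def using unimodular_ker_power ker_\<pi> by blast

lemma \<pi>_N: "\<pi> (N y) = N (\<pi> y)"
  by (simp add: N_def linear_add[OF linear_\<pi>] comm)

lemma N_in_F: "\<pi> h = 0 \<Longrightarrow> N h \<in> F"
  by (simp add: F_def \<pi>_N linear_0[OF linear_N])

text \<open>Off the range of \<open>\<pi>\<close> the operator \<open>\<beta>\<close> is replaced by multiplication by 2, for which
  \<open>I \<plusminus> \<beta>\<close> are invertible.\<close>

definition \<beta>' :: "real^'n \<Rightarrow> real^'n" where "\<beta>' x = \<beta> (\<pi> x) + 2 *\<^sub>R (x - \<pi> x)"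

lemma \<pi>_\<beta>': "\<pi> (\<beta>' x) = \<beta> (\<pi> x)"
  by (simp add: \<beta>'_def linear_add[OF linear_\<pi>] linear_cmul[OF linear_\<pi>] linear_diff[OF linear_\<pi>]
      idem flip: comm)

lemma linear_\<beta>': "linear \<beta>'"
  unfolding \<beta>'_def
  using linear_compose[OF linear_\<pi> linear_\<beta>] linear_\<pi>
  by (intro linear_compose_add linear_compose_scale_right linear_compose_sub linear_ident) (simp_all add: comp_def)

text \<open>If \<open>I + \<beta>'\<close> or \<open>I - \<beta>'\<close> kills \<open>x\<close>,
  then \<open>T\<close> kills \<open>\<pi> x\<close>, so \<open>\<pi> x = 0\<close>. On the kernel
  of \<open>\<pi>\<close> the two operators are multiplication by 3 and by -1.\<close>

lemma inj_\<beta>': "inj \<beta>'" "inj (\<lambda>x. x + \<beta>' x)" "inj (\<lambda>x. x - \<beta>' x)"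
proof -
  have lin: "linear (\<lambda>x. x + \<beta>' x)" "linear (\<lambda>x. x - \<beta>' x)"
    using linear_\<beta>' by (simp_all add: linear_compose_add linear_compose_sub linear_ident)
  show "inj \<beta>'"
    unfolding linear_injective_0[OF linear_\<beta>']
  proof (intro allI impI)
    fix x assume x: "\<beta>' x = 0"
    then have "\<beta> (\<pi> x) = \<beta> 0"
      using \<pi>_\<beta>'[of x] by (simp add: linear_0[OF linear_\<pi>] linear_0[OF linear_\<beta>])
    then have "\<pi> x = 0" using inj_\<beta> by (simp add: inj_eq)
    with x show "x = 0" by (simp add: \<beta>'_def linear_0[OF linear_\<beta>])
  qed
  show "inj (\<lambda>x. x + \<beta>' x)"
    unfolding linear_injective_0[OF lin(1)]
  proof (intro allI impI)
    fix x assume x: "x + \<beta>' x = 0"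
    then have "\<pi> x + \<beta> (\<pi> x) = 0"
      using linear_add[OF linear_\<pi>, of x "\<beta>' x"] by (simp add: \<pi>_\<beta>' linear_0[OF linear_\<pi>])
    then have b: "\<beta> (\<pi> x) = - \<pi> x" by (simp add: add_eq_0_iff)
    then have "T (\<pi> x) = 0" by (simp add: T_def linear_neg[OF linear_\<beta>])
    then have "\<pi> x = 0" by (rule T_\<pi>)
    with x have "x + 2 *\<^sub>R x = 0" by (simp add: \<beta>'_def linear_0[OF linear_\<beta>])
    then have "(1 + 2) *\<^sub>R x = 0" unfolding scaleR_add_left by simp
    then show "x = 0" by simp
  qed
  show "inj (\<lambda>x. x - \<beta>' x)"
    unfolding linear_injective_0[OF lin(2)]
  proof (intro allI impI)
    fix x assume x: "x - \<beta>' x = 0"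
    have "\<pi> x - \<beta> (\<pi> x) = \<pi> (x - \<beta>' x)"
      by (simp add: linear_diff[OF linear_\<pi>] \<pi>_\<beta>')
    also have "\<dots> = 0" unfolding x by (rule linear_0[OF linear_\<pi>])
    finally have "\<beta> (\<pi> x) = \<pi> x" by simp
    then have "T (\<pi> x) = 0" by (simp add: T_def)
    then have "\<pi> x = 0" by (rule T_\<pi>)
    with x show "x = 0" by (simp add: \<beta>'_def linear_0[OF linear_\<beta>] scaleR_2)
  qed
qed

text \<open>As \<open>\<pi>\<close> carries \<open>\<beta>'\<close> to \<open>\<beta>\<close>, the
  equation at \<open>(u, v)\<close> is the original one at
  \<open>(\<pi> u, \<pi> v)\<close>.\<close>

lemma nondegenerate: "nondegenerate_heyde (\<lambda>y. f\<^sub>1 (\<pi> y)) (\<lambda>y. f\<^sub>2 (\<pi> y)) \<beta>'"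
proof (rule nondegenerate_heyde.intro)
  have c: "continuous_on UNIV \<pi>"
    using linear_\<pi> by (simp add: linear_continuous_on linear_conv_bounded_linear)
  show "continuous_on UNIV (\<lambda>y. f\<^sub>1 (\<pi> y))" "continuous_on UNIV (\<lambda>y. f\<^sub>2 (\<pi> y))"
    by (rule continuous_on_compose2[OF f_cont(1) c] continuous_on_compose2[OF f_cont(2) c]; simp)+
  show "f\<^sub>1 (\<pi> 0) = 1" "f\<^sub>2 (\<pi> 0) = 1" by (simp_all add: linear_0[OF linear_\<pi>] f_0)
  show "f\<^sub>1 (\<pi> (- y)) = cnj (f\<^sub>1 (\<pi> y))" "f\<^sub>2 (\<pi> (- y)) = cnj (f\<^sub>2 (\<pi> y))" for y
    by (simp_all add: linear_neg[OF linear_\<pi>] f_cnj)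
  show "f\<^sub>1 (\<pi> (u + v)) * f\<^sub>2 (\<pi> (u + \<beta>' v)) = f\<^sub>1 (\<pi> (u - v)) * f\<^sub>2 (\<pi> (u - \<beta>' v))" for u v
    using heyde[of "\<pi> u" "\<pi> v"]
    by (simp add: linear_add[OF linear_\<pi>] linear_diff[OF linear_\<pi>] \<pi>_\<beta>')
qed (fact linear_\<beta>' inj_\<beta>')+

lemma gaussian_\<pi>:
  assumes f: "f = f\<^sub>1 \<or> f = f\<^sub>2"
  obtains A b where "transpose A = A" "\<And>y. 0 \<le> (A *v y) \<bullet> y"
    "\<And>y. f (\<pi> y) = exp (- complex_of_real ((A *v y) \<bullet> y) + \<i> * complex_of_real (b \<bullet> \<pi> y))"
proof -
  interpret nd: nondegenerate_heyde "\<lambda>y. f\<^sub>1 (\<pi> y)" "\<lambda>y. f\<^sub>2 (\<pi> y)" \<beta>' by (rule nondegenerate)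
  obtain g \<beta>'' where nd: "nondegenerate_heyde (\<lambda>y. f (\<pi> y)) g \<beta>''"
    using f nondegenerate nd.swap by metis
  have le: "cmod (f (\<pi> y)) \<le> 1" for y using f f_le by auto
  show ?thesis
  proof (rule nondegenerate_heyde_gaussian[OF nd le])
    fix A b
    assume A: "transpose A = A" "\<And>y. 0 \<le> (A *v y) \<bullet> y"
      and fA: "\<And>y. f (\<pi> y) = exp (- complex_of_real ((A *v y) \<bullet> y) + \<i> * complex_of_real (b \<bullet> y))"
    have "f (\<pi> y) = exp (- complex_of_real ((A *v y) \<bullet> y) + \<i> * complex_of_real (b \<bullet> \<pi> y))" for y
    proof -
      \<comment> \<open>Comparing moduli shows that the quadratic form depends on
        \<open>\<pi> y\<close> only. Evaluating at \<open>\<pi> y\<close> then puts the linear term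
        in the required form.\<close>
      have "cmod (f (\<pi> (\<pi> y))) = cmod (f (\<pi> y))" by (simp add: idem)
      then have "(A *v \<pi> y) \<bullet> \<pi> y = (A *v y) \<bullet> y"
        unfolding fA norm_exp_eq_Re by simp
      then show ?thesis using fA[of "\<pi> y"] by (simp add: idem)
    qed
    then show ?thesis by (rule that[OF A])
  qed
qed

lemma nonvanishing_\<pi>: "\<pi> y = y \<Longrightarrow> f\<^sub>1 y \<noteq> 0 \<and> f\<^sub>2 y \<noteq> 0"
  using nondegenerate_heyde.nonvanishing[OF nondegenerate, of y] by simp

text \<open>Invertibility of \<open>I + \<beta>'\<close> gives \<open>y = x + \<beta>' x\<close>;
  applying \<open>\<pi>\<close> turns this into \<open>y = N (\<pi> x)\<close>.\<close>

lemma N_surj_\<pi>: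
  assumes "\<pi> y = y"
  obtains z where "\<pi> z = z" "N z = y"
proof -
  have "linear (\<lambda>x. x + \<beta>' x)"
    using linear_\<beta>' by (simp add: linear_compose_add linear_ident)
  then obtain x where "y = x + \<beta>' x"
    using linear_inj_imp_surj[OF _ inj_\<beta>'(2)] by (metis surjD)
  then have "N (\<pi> x) = y"
    using assms by (metis N_def \<pi>_\<beta>' linear_add[OF linear_\<pi>])
  then show ?thesis using that[of "\<pi> x"] idem by simp
qed

lemma f_add_F:
  assumes "\<pi> h = 0"
  defines "w \<equiv> N h /\<^sub>R 2"
  shows "f\<^sub>2 (y + w) = f\<^sub>2 y * f\<^sub>2 w" "f\<^sub>2 (y - w) = f\<^sub>2 y * f\<^sub>2 (- w)" "f\<^sub>2 w \<noteq> 0" "f\<^sub>2 (- w) \<noteq> 0"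
proof -
  have "w \<in> F" "- w \<in> F"
    using N_in_F[OF assms(1)] subspace_F by (auto simp: w_def subspace_scale subspace_neg)
  then have "cmod (f\<^sub>2 w) = 1" "cmod (f\<^sub>2 (- w)) = 1" using unimodular_F by blast+
  then show "f\<^sub>2 (y + w) = f\<^sub>2 y * f\<^sub>2 w" "f\<^sub>2 (y - w) = f\<^sub>2 y * f\<^sub>2 (- w)" "f\<^sub>2 w \<noteq> 0" "f\<^sub>2 (- w) \<noteq> 0"
    using f_shift(2)[of w y] f_shift(2)[of "- w" y] by auto
qed

lemma f_ker_\<pi>:
  assumes h: "\<pi> h = 0"
  shows "f\<^sub>1 h * f\<^sub>2 (N h /\<^sub>R 2) = f\<^sub>2 h * f\<^sub>2 (- (N h /\<^sub>R 2))"
  using heyde_N[of h 0] f_add_F(2)[OF h, of h] by (simp add: f_0)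

text \<open>The equation for a vector \<open>k\<close> in the kernel of \<open>\<pi>\<close> is
  compared with its case \<open>k = 0\<close>. Shifts by \<open>N h /\<^sub>R 2\<close> lie in
  \<open>F\<close> and split off as factors, \<open>f_ker_\<pi>\<close> balances these factors, and
  values on the range of \<open>\<pi>\<close> can be cancelled.\<close>

lemma f_product:
  assumes y: "\<pi> y = y" and h: "\<pi> h = 0"
  shows "f\<^sub>1 (y + h) = f\<^sub>1 y * f\<^sub>1 h" "f\<^sub>2 (y + h) = f\<^sub>2 y * f\<^sub>2 h"
proof -
  obtain z where z: "\<pi> z = z" "N z = y" using N_surj_\<pi>[OF y] by blast
  define w where "w = N h /\<^sub>R 2"
  note w = f_add_F[OF h, folded w_def]
  have fh: "f\<^sub>1 h * f\<^sub>2 w = f\<^sub>2 h * f\<^sub>2 (- w)" using f_ker_\<pi>[OF h] by (simp add: w_def)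
  \<comment> \<open>Chosen so that \<open>N (y + k - b) /\<^sub>R 2 = y + N k /\<^sub>R 2\<close>,
    which removes \<open>y\<close> from the argument of \<open>f\<^sub>2\<close> on the right-hand
    side.\<close>
  define b where "b = y - 2 *\<^sub>R z"
  have "\<pi> b = b" using y z by (simp add: b_def linear_diff[OF linear_\<pi>] linear_cmul[OF linear_\<pi>])
  then have nz: "f\<^sub>1 b \<noteq> 0" using nonvanishing_\<pi> by blast
  have "N (y + k - b) /\<^sub>R 2 = y + N k /\<^sub>R 2" for k
    by (simp add: b_def linear_add[OF linear_N] linear_diff[OF linear_N] linear_cmul[OF linear_N] z algebra_simps)
  then have E: "f\<^sub>1 (y + k) * f\<^sub>2 (b + y + N k /\<^sub>R 2) = f\<^sub>1 b * f\<^sub>2 (k - N k /\<^sub>R 2)" for k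
    using heyde_N[of "y + k" b] by (simp add: add.assoc)
  have E0: "f\<^sub>1 y * f\<^sub>2 (b + y) = f\<^sub>1 b"
    using E[of 0] by (simp add: linear_0[OF linear_N] f_0)
  have "f\<^sub>1 (y + h) * f\<^sub>2 (b + y) * f\<^sub>2 w = f\<^sub>1 b * (f\<^sub>2 h * f\<^sub>2 (- w))"
    using E[of h] w(1)[of "b + y"] w(2)[of h] by (simp add: w_def mult.assoc)
  also have "\<dots> = f\<^sub>1 y * f\<^sub>1 h * f\<^sub>2 (b + y) * f\<^sub>2 w"
    unfolding fh[symmetric] E0[symmetric] by (simp add: mult_ac)
  finally have "(f\<^sub>1 (y + h) - f\<^sub>1 y * f\<^sub>1 h) * f\<^sub>2 (b + y) * f\<^sub>2 w = 0"
    by (simp add: left_diff_distrib)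
  moreover have "f\<^sub>2 (b + y) \<noteq> 0" using E0 nz by auto
  ultimately show "f\<^sub>1 (y + h) = f\<^sub>1 y * f\<^sub>1 h" using w(3) by simp

  \<comment> \<open>For \<open>f\<^sub>2\<close> the same comparison uses
    \<open>a = 2 *\<^sub>R z\<close> and \<open>c = k\<close>, which isolates
    \<open>f\<^sub>2 (y + k - N k /\<^sub>R 2)\<close>.\<close>
  have nz2: "f\<^sub>1 (2 *\<^sub>R z) \<noteq> 0"
    using nonvanishing_\<pi>[of "2 *\<^sub>R z"] z by (simp add: linear_cmul[OF linear_\<pi>])
  have half: "N (2 *\<^sub>R z - k) /\<^sub>R 2 = y - N k /\<^sub>R 2" for k
    by (simp add: linear_diff[OF linear_N] linear_cmul[OF linear_N] z algebra_simps)
  have D: "f\<^sub>1 (2 *\<^sub>R z) * f\<^sub>2 (y + k - N k /\<^sub>R 2) = f\<^sub>1 k * f\<^sub>2 (2 *\<^sub>R z - y + N k /\<^sub>R 2)" for k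
    using heyde_N[of "2 *\<^sub>R z" k] unfolding half by (simp add: algebra_simps)
  have D0: "f\<^sub>1 (2 *\<^sub>R z) * f\<^sub>2 y = f\<^sub>2 (2 *\<^sub>R z - y)"
    using D[of 0] by (simp add: linear_0[OF linear_N] f_0)
  have "f\<^sub>1 (2 *\<^sub>R z) * f\<^sub>2 (y + h) * f\<^sub>2 (- w) = f\<^sub>1 h * f\<^sub>2 w * f\<^sub>2 (2 *\<^sub>R z - y)"
    using D[of h] w(1)[of "2 *\<^sub>R z - y"] w(2)[of "y + h"] by (simp add: w_def mult_ac)
  also have "\<dots> = f\<^sub>1 (2 *\<^sub>R z) * (f\<^sub>2 y * f\<^sub>2 h) * f\<^sub>2 (- w)"
    unfolding fh D0[symmetric] by (simp add: mult_ac)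
  finally have "f\<^sub>1 (2 *\<^sub>R z) * (f\<^sub>2 (y + h) - f\<^sub>2 y * f\<^sub>2 h) * f\<^sub>2 (- w) = 0"
    by (simp add: right_diff_distrib left_diff_distrib)
  then show "f\<^sub>2 (y + h) = f\<^sub>2 y * f\<^sub>2 h" using nz2 w(4) by simp
qed

lemma f_split: "f\<^sub>1 y = f\<^sub>1 (\<pi> y) * f\<^sub>1 (y - \<pi> y)" "f\<^sub>2 y = f\<^sub>2 (\<pi> y) * f\<^sub>2 (y - \<pi> y)"
  using f_product[of "\<pi> y" "y - \<pi> y"] by (simp_all add: idem linear_diff[OF linear_\<pi>])

text \<open>The vector \<open>b\<close> is the point at which the second distribution is
  concentrated in the directions of \<open>F\<close>. Inserting the resulting character into
  \<open>f_ker_\<pi>\<close> gives the first claim, and restricting that to \<open>F\<close> gives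
  the second.\<close>

lemma kernel_shift:
  obtains b where "\<And>h. \<pi> h = 0 \<Longrightarrow> f\<^sub>2 h = f\<^sub>1 h * iexp (b \<bullet> N h)"
    "\<And>w. w \<in> F \<Longrightarrow> f\<^sub>1 w = iexp (- (b \<bullet> \<beta> w))"
proof -
  obtain b where b: "AE x in \<mu>\<^sub>2. \<forall>w\<in>F. x \<bullet> w = b \<bullet> w"
    using unimodular_subspace_AE[OF dist(2) subspace_F] unimodular_F unfolding f\<^sub>2_def by blast
  interpret prob_space \<mu>\<^sub>2 using dist by (simp add: is_distribution_def)
  note [measurable_cong] = is_distributionD(2)[OF dist(2)]
  have f2: "f\<^sub>2 w = iexp (b \<bullet> w)" if "w \<in> F" for w
  proof -
    have "f\<^sub>2 w = (CLINT x|\<mu>\<^sub>2. iexp (b \<bullet> w))"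
      unfolding f\<^sub>2_def char_fun_def using b that by (intro integral_cong_AE) auto
    then show ?thesis by (simp add: prob_space)
  qed
  have 1: "f\<^sub>2 h = f\<^sub>1 h * iexp (b \<bullet> N h)" if h: "\<pi> h = 0" for h
  proof -
    have F: "N h /\<^sub>R 2 \<in> F" "- (N h /\<^sub>R 2) \<in> F"
      using N_in_F[OF h] subspace_F by (auto simp: subspace_scale subspace_neg)
    have "f\<^sub>1 h * iexp (b \<bullet> N h) = f\<^sub>1 h * iexp (b \<bullet> (N h /\<^sub>R 2)) * iexp (b \<bullet> (N h /\<^sub>R 2))"
      by (simp add: mult.assoc exp_add[symmetric])
    also have "\<dots> = f\<^sub>2 h * (iexp (b \<bullet> - (N h /\<^sub>R 2)) * iexp (b \<bullet> (N h /\<^sub>R 2)))"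
      using f_ker_\<pi>[OF h] unfolding f2[OF F(1)] f2[OF F(2)] by (simp add: mult.assoc)
    also have "\<dots> = f\<^sub>2 h" by (simp add: exp_add[symmetric])
    finally show ?thesis by simp
  qed
  moreover have "f\<^sub>1 w = iexp (- (b \<bullet> \<beta> w))" if w: "w \<in> F" for w
  proof -
    have "f\<^sub>1 w * iexp (b \<bullet> N w) * iexp (- (b \<bullet> N w)) = iexp (b \<bullet> w) * iexp (- (b \<bullet> N w))"
      using 1[of w] f2[OF w] w by (simp add: F_def)
    then show ?thesis
      by (simp add: mult.assoc exp_add[symmetric] N_def inner_add_right algebra_simps)
  qed
  ultimately show ?thesis by (rule that)
qed

end

subsection \<open>The theorem\<close>

lemma supported_in_distr_affine:
  fixes T :: "real^'n \<Rightarrow> real^'n"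
  assumes \<mu>: "is_distribution \<mu>" and T: "linear T" and b: "b \<in> range T"
  shows "supported_in (distr \<mu> borel (\<lambda>x. T x + b)) (range T)"
proof -
  interpret prob_space \<mu> using \<mu> by (simp add: is_distribution_def)
  note [measurable_cong] = is_distributionD(2)[OF \<mu>]
  note [measurable] = linear_borel_measurable[OF T]
  have sub: "subspace (range T)" by (rule linear_subspace_image[OF T subspace_UNIV])
  then have [measurable]: "range T \<in> sets borel" by (simp add: closed_subspace borel_closed)
  have "(\<lambda>x. T x + b) -` range T \<inter> space \<mu> = space \<mu>"
    using sub b by (auto intro: subspace_add)
  then show ?thesis
    unfolding supported_in_def by (subst emeasure_distr) (auto simp: emeasure_space_1)
qed

text \<open>The range of \<open>?N\<close> is orthogonal to the kernel of
  \<open>I + \<alpha>\<close> and determines it. Degeneracy in the directions of this range leaves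
  only a centre \<open>b\<close>, which must be orthogonal to it too.\<close>

lemma supported_in_if_char_fun_eq_1:
  fixes \<omega> :: "(real^'n) measure"
  assumes \<omega>: "is_distribution \<omega>" and \<alpha>: "linear \<alpha>"
    and one: "\<And>c. char_fun \<omega> (c + adjoint \<alpha> c) = 1"
  shows "supported_in \<omega> {x. x + \<alpha> x = 0}"
proof -
  interpret prob_space \<omega> using \<omega> by (simp add: is_distribution_def)
  note [measurable_cong] = is_distributionD(2)[OF \<omega>]
  let ?N = "\<lambda>c. c + adjoint \<alpha> c"
  have N: "linear ?N"
    using adjoint_linear[OF \<alpha>] by (intro linear_compose_add linear_ident)
  have W: "subspace (range ?N)" by (rule linear_subspace_image[OF N subspace_UNIV])
  have "cmod (char_fun \<omega> w) = 1" if "w \<in> range ?N" for w using one that by auto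
  then obtain b where b: "AE x in \<omega>. \<forall>w\<in>range ?N. x \<bullet> w = b \<bullet> w"
    using unimodular_subspace_AE[OF \<omega> W] by blast
  have bN: "b \<bullet> ?N c = 0" for c
  proof (rule ccontr)
    assume nz: "b \<bullet> ?N c \<noteq> 0"
    \<comment> \<open>Rescaling makes the phase equal to pi, where the characteristic function would
      be -1 instead of 1.\<close>
    define c' where "c' = (pi / (b \<bullet> ?N c)) *\<^sub>R c"
    have "b \<bullet> ?N c' = (pi / (b \<bullet> ?N c)) * (b \<bullet> ?N c)"
      unfolding c'_def linear_cmul[OF N] by simp
    then have pi: "b \<bullet> ?N c' = pi" using nz by simp
    have "char_fun \<omega> (?N c') = (CLINT x|\<omega>. iexp (b \<bullet> ?N c'))"
      unfolding char_fun_def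
    proof (rule integral_cong_AE)
      show "AE x in \<omega>. iexp (x \<bullet> ?N c') = iexp (b \<bullet> ?N c')"
        using b by (rule AE_mp) (intro AE_I2 impI, metis rangeI)
    qed auto
    then show False
      using one[of c'] unfolding pi by (simp add: prob_space)
  qed
  have closed: "closed {x. x + \<alpha> x = 0}"
    using \<alpha> by (intro closed_Collect_eq continuous_intros linear_continuous_on) (simp add: linear_conv_bounded_linear)
  have "AE x in \<omega>. x \<in> {x. x + \<alpha> x = 0}"
    using b
  proof (rule AE_mp, intro AE_I2 impI)
    fix x assume x: "\<forall>w\<in>range ?N. x \<bullet> w = b \<bullet> w"
    have "(x + \<alpha> x) \<bullet> c = x \<bullet> ?N c" for c
      by (simp add: inner_add_left inner_add_right adjoint_works[OF \<alpha>])
    then have "(x + \<alpha> x) \<bullet> c = 0" for c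
      using x bN by (metis rangeI)
    then show "x \<in> {x. x + \<alpha> x = 0}"
      using inner_eq_zero_iff by blast
  qed
  then show ?thesis
    unfolding supported_in_def using closed is_distributionD(2)[OF \<omega>]
    by (subst emeasure_eq_1_AE) (auto simp: borel_closed)
qed

lemma shift_eqI:
  fixes \<mu> :: "(real^'n) measure"
  assumes "is_distribution \<mu>" "is_distribution \<gamma>" "is_distribution \<omega>"
    and "\<And>y. char_fun \<mu> y = char_fun \<gamma> y * char_fun \<omega> y * iexp (x \<bullet> y)"
  shows "\<mu> = ((\<gamma> \<star> \<omega>) \<star> return borel x)"
  using assms
  by (intro char_fun_unique)
    (simp_all add: is_distribution_convolution is_distribution_return char_fun_convolution char_fun_return)

theorem theorem2p1:
  fixes \<alpha> :: "real ^ 'n \<Rightarrow> real ^ 'n"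
    and K :: "(real ^ 'n) set"
    and M :: "'m measure"
    and \<xi>\<^sub>1 \<xi>\<^sub>2 :: "'m \<Rightarrow> real ^ 'n"
    and \<mu>\<^sub>1 \<mu>\<^sub>2 :: "(real ^ 'n) measure"
  assumes "linear \<alpha>" and "bij \<alpha>"
    and "K = {x. x + \<alpha> x = 0}"
    and "prob_space M"
    and "prob_space.indep_var M borel \<xi>\<^sub>1 borel \<xi>\<^sub>2"
    and "\<mu>\<^sub>1 = distr M borel \<xi>\<^sub>1" and "\<mu>\<^sub>2 = distr M borel \<xi>\<^sub>2"
    and "symmetric_cond_distribution M
           (\<lambda>\<omega>. \<xi>\<^sub>1 \<omega> + \<alpha> (\<xi>\<^sub>2 \<omega>)) (\<lambda>\<omega>. \<xi>\<^sub>1 \<omega> + \<xi>\<^sub>2 \<omega>)"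
  shows "\<exists>G. subspace G \<and> \<alpha> ` G \<subseteq> G \<and> K \<inter> G = {0} \<and>
    (\<exists>\<gamma>\<^sub>1 \<gamma>\<^sub>2 \<omega> x\<^sub>1 x\<^sub>2.
        symmetric_gaussian \<gamma>\<^sub>1 \<and> supported_in \<gamma>\<^sub>1 G \<and>
        symmetric_gaussian \<gamma>\<^sub>2 \<and> supported_in \<gamma>\<^sub>2 G \<and>
        is_distribution \<omega> \<and> supported_in \<omega> K \<and>
        \<mu>\<^sub>1 = ((\<gamma>\<^sub>1 \<star> \<omega>) \<star> return borel x\<^sub>1) \<and>
        \<mu>\<^sub>2 = ((\<gamma>\<^sub>2 \<star> \<omega>) \<star> return borel x\<^sub>2))"
proof -

  \<comment> \<open>Functional equation and Fitting projection for the adjoint\<close>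
  note \<alpha> = \<open>linear \<alpha>\<close>
  interpret prob_space M by fact
  have rv: "random_variable borel \<xi>\<^sub>1" "random_variable borel \<xi>\<^sub>2"
    using indep_var_rv1[OF assms(5)] indep_var_rv2[OF assms(5)] by auto
  define \<beta> where "\<beta> = adjoint \<alpha>"
  have \<beta>: "linear \<beta>" unfolding \<beta>_def by (rule adjoint_linear[OF \<alpha>])
  have adj: "x \<bullet> \<beta> y = \<alpha> x \<bullet> y" for x y unfolding \<beta>_def by (rule adjoint_works[OF \<alpha>])
  interpret hd: heyde_distributions \<mu>\<^sub>1 \<mu>\<^sub>2 \<beta> "char_fun \<mu>\<^sub>1" "char_fun \<mu>\<^sub>2" "\<lambda>x. x + \<beta> x" "\<lambda>x. x - \<beta> (\<beta> x)"
  proof (unfold_locales)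
    show "is_distribution \<mu>\<^sub>1" "is_distribution \<mu>\<^sub>2"
      unfolding assms(6,7) by (intro is_distribution_distr rv prob_space_axioms)+
    show "inj \<beta>" unfolding \<beta>_def using \<open>bij \<alpha>\<close> \<alpha> by (simp add: bij_is_surj)
    show "char_fun \<mu>\<^sub>1 (u + v) * char_fun \<mu>\<^sub>2 (u + \<beta> v) = char_fun \<mu>\<^sub>1 (u - v) * char_fun \<mu>\<^sub>2 (u - \<beta> v)" for u v
      unfolding assms(6,7) \<beta>_def by (rule heyde_equation[OF \<alpha> assms(4,5,8)])
  qed (use \<beta> linear_add linear_cmul in auto)
  note dist = hd.dist
  obtain \<pi> m where \<pi>: "linear \<pi>" "\<And>y. \<pi> (\<pi> y) = \<pi> y"
    "\<And>y. \<pi> y - \<beta> (\<beta> (\<pi> y)) = 0 \<Longrightarrow> \<pi> y = 0"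
    "\<And>y. \<pi> y = 0 \<Longrightarrow> ((\<lambda>x. x - \<beta> (\<beta> x)) ^^ m) y = 0"
    "\<And>y. \<beta> (\<pi> y) = \<pi> (\<beta> y)"
  proof (rule fitting_projection[OF hd.linear_T])
    fix \<pi> m
    assume a: "linear \<pi>" "\<And>y. \<pi> (\<pi> y) = \<pi> y"
      "\<And>y. \<pi> y - \<beta> (\<beta> (\<pi> y)) = 0 \<Longrightarrow> \<pi> y = 0"
      "\<And>y. \<pi> y = 0 \<Longrightarrow> ((\<lambda>x. x - \<beta> (\<beta> x)) ^^ m) y = 0"
      "\<And>\<beta>' y. (\<And>y. \<beta>' (y - \<beta> (\<beta> y)) = \<beta>' y - \<beta> (\<beta> (\<beta>' y))) \<Longrightarrow> \<beta>' (\<pi> y) = \<pi> (\<beta>' y)"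
    have comm: "\<beta> (\<pi> y) = \<pi> (\<beta> y)" for y
      by (rule a(5)) (simp add: linear_diff[OF \<beta>])
    show thesis
      by (rule that[of \<pi> m]) (fact a(1) a(2) a(3) a(4) comm)+
  qed
  interpret hf: heyde_fitting \<mu>\<^sub>1 \<mu>\<^sub>2 \<beta> "char_fun \<mu>\<^sub>1" "char_fun \<mu>\<^sub>2" "\<lambda>x. x + \<beta> x" "\<lambda>x. x - \<beta> (\<beta> x)" \<pi> m
    by (unfold_locales) (use \<pi> linear_add linear_cmul in auto)
  \<comment> \<open>Pushing a distribution forward along \<open>p\<close> composes its
    characteristic function with \<open>\<pi>\<close>; along \<open>q\<close> it is composed with
    \<open>I - \<pi>\<close>.\<close>
  define p where "p = adjoint \<pi>"
  have p: "linear p" unfolding p_def by (rule adjoint_linear[OF \<pi>(1)])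
  have padj: "p x \<bullet> y = x \<bullet> \<pi> y" for x y
    unfolding p_def using adjoint_clauses(2)[OF \<pi>(1)] by simp
  have adjp: "adjoint p = \<pi>" unfolding p_def by (rule adjoint_adjoint[OF \<pi>(1)])
  define q where "q = (\<lambda>x. x - p x)"
  have q: "linear q" unfolding q_def by (intro linear_compose_sub linear_ident p)
  have adjq: "adjoint q = (\<lambda>y. y - \<pi> y)"
    by (rule adjoint_unique) (simp add: q_def inner_diff_left inner_diff_right padj)
  define G where "G = range p"

  \<comment> \<open>The Gaussian factors in \<open>G\<close>\<close>
  have ex_\<gamma>: "\<exists>\<gamma> b. symmetric_gaussian \<gamma> \<and> supported_in \<gamma> G \<and>
      (\<forall>y. char_fun \<mu> (\<pi> y) = char_fun \<gamma> y * iexp (p b \<bullet> y))"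
    if \<mu>: "is_distribution \<mu>" and f: "char_fun \<mu> = char_fun \<mu>\<^sub>1 \<or> char_fun \<mu> = char_fun \<mu>\<^sub>2" for \<mu>
  proof (rule hf.gaussian_\<pi>[OF f])
    fix A b
    assume A: "transpose A = A" "\<And>y. 0 \<le> (A *v y) \<bullet> y"
      and fA: "\<And>y. char_fun \<mu> (\<pi> y) = exp (- complex_of_real ((A *v y) \<bullet> y) + \<i> * complex_of_real (b \<bullet> \<pi> y))"
    \<comment> \<open>The projected distribution, centred by a vector of \<open>G\<close> so that it
      remains supported in \<open>G\<close>.\<close>
    define \<gamma> where "\<gamma> = distr \<mu> borel (\<lambda>x. p x + p (- b))"
    have cf: "char_fun \<gamma> y = exp (- complex_of_real ((A *v y) \<bullet> y))" for y
      unfolding \<gamma>_def char_fun_distr_affine[OF \<mu> p] adjp fA padj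
      by (simp add: exp_add[symmetric])
    have "is_distribution \<gamma>"
      unfolding \<gamma>_def by (rule is_distribution_distr_affine[OF \<mu> p])
    then have "symmetric_gaussian \<gamma>"
      unfolding symmetric_gaussian_def gaussian_with_def using A cf by auto
    moreover have "supported_in \<gamma> G"
      unfolding \<gamma>_def G_def by (rule supported_in_distr_affine[OF \<mu> p]) simp
    moreover have "char_fun \<mu> (\<pi> y) = char_fun \<gamma> y * iexp (p b \<bullet> y)" for y
      unfolding cf fA padj exp_add ..
    ultimately show ?thesis by blast
  qed
  obtain \<gamma>\<^sub>1 b\<^sub>1 where \<gamma>1: "symmetric_gaussian \<gamma>\<^sub>1" "supported_in \<gamma>\<^sub>1 G"
    "\<And>y. char_fun \<mu>\<^sub>1 (\<pi> y) = char_fun \<gamma>\<^sub>1 y * iexp (p b\<^sub>1 \<bullet> y)"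
    using ex_\<gamma>[OF dist(1)] by blast
  obtain \<gamma>\<^sub>2 b\<^sub>2 where \<gamma>2: "symmetric_gaussian \<gamma>\<^sub>2" "supported_in \<gamma>\<^sub>2 G"
    "\<And>y. char_fun \<mu>\<^sub>2 (\<pi> y) = char_fun \<gamma>\<^sub>2 y * iexp (p b\<^sub>2 \<bullet> y)"
    using ex_\<gamma>[OF dist(2)] by blast
  have \<gamma>_dist: "is_distribution \<gamma>\<^sub>1" "is_distribution \<gamma>\<^sub>2"
    using \<gamma>1(1) \<gamma>2(1) unfolding symmetric_gaussian_def gaussian_with_def by blast+

  \<comment> \<open>The common factor in \<open>K\<close> and the two shifts\<close>
  obtain b where b: "\<And>h. \<pi> h = 0 \<Longrightarrow> char_fun \<mu>\<^sub>2 h = char_fun \<mu>\<^sub>1 h * iexp (b \<bullet> (h + \<beta> h))"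
    "\<And>w. w \<in> hf.F \<Longrightarrow> char_fun \<mu>\<^sub>1 w = iexp (- (b \<bullet> \<beta> w))"
    using hf.kernel_shift by blast
  \<comment> \<open>The shift cancels the character of the first distribution on \<open>F\<close>,
    so that the characteristic function of \<open>\<omega>\<close> is 1 on the range of
    \<open>I + \<beta>\<close>.\<close>
  define \<omega> where "\<omega> = distr \<mu>\<^sub>1 borel (\<lambda>x. q x + q (\<alpha> b))"
  have qadj: "q x \<bullet> y = x \<bullet> (y - \<pi> y)" for x y
    by (simp add: q_def inner_diff_left inner_diff_right padj)
  have \<pi>0: "\<pi> (y - \<pi> y) = 0" for y by (simp add: linear_diff[OF \<pi>(1)] \<pi>(2))
  have cf\<omega>: "char_fun \<omega> y = char_fun \<mu>\<^sub>1 (y - \<pi> y) * iexp (b \<bullet> \<beta> (y - \<pi> y))" for y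
    unfolding \<omega>_def char_fun_distr_affine[OF dist(1) q] adjq qadj adj ..
  have \<omega>: "is_distribution \<omega>"
    unfolding \<omega>_def by (rule is_distribution_distr_affine[OF dist(1) q])
  have "supported_in \<omega> K"
    unfolding assms(3)
  proof (rule supported_in_if_char_fun_eq_1[OF \<omega> \<alpha>])
    fix c
    have split: "c + \<beta> c - \<pi> (c + \<beta> c) = (c - \<pi> c) + \<beta> (c - \<pi> c)"
      by (simp add: linear_add[OF \<pi>(1)] linear_diff[OF \<beta>] \<pi>(5) algebra_simps)
    have F: "c + \<beta> c - \<pi> (c + \<beta> c) \<in> hf.F"
      unfolding split by (rule hf.N_in_F[OF \<pi>0[of c]])
    show "char_fun \<omega> (c + adjoint \<alpha> c) = 1"
      unfolding \<beta>_def[symmetric] cf\<omega> b(2)[OF F] by (simp add: exp_add[symmetric])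
  qed
  moreover have "\<mu>\<^sub>1 = ((\<gamma>\<^sub>1 \<star> \<omega>) \<star> return borel (p b\<^sub>1 - q (\<alpha> b)))"
  proof (rule shift_eqI[OF dist(1) \<gamma>_dist(1) \<omega>])
    fix y
    have "char_fun \<mu>\<^sub>1 (y - \<pi> y) = char_fun \<omega> y * iexp (- (q (\<alpha> b) \<bullet> y))"
      unfolding cf\<omega> qadj adj by (simp add: mult.assoc exp_add[symmetric])
    then show "char_fun \<mu>\<^sub>1 y = char_fun \<gamma>\<^sub>1 y * char_fun \<omega> y * iexp ((p b\<^sub>1 - q (\<alpha> b)) \<bullet> y)"
      using hf.f_split(1)[of y] \<gamma>1(3)[of y]
      by (simp add: inner_diff_left right_diff_distrib exp_diff exp_minus divide_inverse mult_ac)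
  qed
  \<comment> \<open>For \<open>h = y - \<pi> y\<close> the two functions differ by the character
    \<open>b \<bullet> (h + \<beta> h)\<close>. The part with \<open>\<beta> h\<close> is already in
    \<open>\<omega>\<close>; the part \<open>b \<bullet> h\<close> is the shift by
    \<open>q b\<close>.\<close>
  moreover have "\<mu>\<^sub>2 = ((\<gamma>\<^sub>2 \<star> \<omega>) \<star> return borel (p b\<^sub>2 + q b))"
  proof (rule shift_eqI[OF dist(2) \<gamma>_dist(2) \<omega>])
    fix y
    have "char_fun \<mu>\<^sub>2 (y - \<pi> y) = char_fun \<omega> y * iexp (q b \<bullet> y)"
      unfolding cf\<omega> qadj b(1)[OF \<pi>0] inner_add_right by (simp add: distrib_left exp_add mult_ac)
    then show "char_fun \<mu>\<^sub>2 y = char_fun \<gamma>\<^sub>2 y * char_fun \<omega> y * iexp ((p b\<^sub>2 + q b) \<bullet> y)"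
      using hf.f_split(2)[of y] \<gamma>2(3)[of y]
      by (simp add: inner_add_left distrib_left exp_add mult_ac)
  qed

  \<comment> \<open>Invariance of \<open>G\<close> and its intersection with
    \<open>K\<close>\<close>
  moreover have "subspace G"
    unfolding G_def by (rule linear_subspace_image[OF p subspace_UNIV])
  moreover have "\<alpha> ` G \<subseteq> G"
  proof -
    have "\<alpha> (p x) = p (\<alpha> x)" for x
    proof -
      have "\<alpha> (p x) \<bullet> y = p (\<alpha> x) \<bullet> y" for y
        by (simp add: padj \<pi>(5) flip: adj)
      then show ?thesis by (metis vector_eq_rdot)
    qed
    then show ?thesis by (auto simp: G_def)
  qed
  moreover have "K \<inter> G = {0}"
  proof -
    have "x = 0" if "x + \<alpha> x = 0" "x = p x'" for x x'
    proof -
      have "x \<bullet> y = 0" for y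
      proof -
        \<comment> \<open>Writing \<open>\<pi> y\<close> as a value of \<open>I + \<beta>\<close>
          moves this operator to \<open>I + \<alpha>\<close> acting on \<open>x\<close>, which
          vanishes on \<open>K\<close>.\<close>
        obtain z where z: "z + \<beta> z = \<pi> y"
          using hf.N_surj_\<pi>[of "\<pi> y"] \<pi>(2) by blast
        have "x \<bullet> y = x \<bullet> \<pi> y" using that(2) by (simp add: padj \<pi>(2))
        also have "\<dots> = (x + \<alpha> x) \<bullet> z"
          unfolding z[symmetric] by (simp add: inner_add_left inner_add_right adj)
        finally show ?thesis using that(1) by simp
      qed
      then show ?thesis using inner_eq_zero_iff by blast
    qed
    moreover have "0 \<in> K" "0 \<in> G"
      using \<alpha> \<open>subspace G\<close> by (auto simp: assms(3) linear_0 subspace_0)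
    ultimately show ?thesis by (auto simp: assms(3) G_def)
  qed
  ultimately show ?thesis
    using \<gamma>1(1,2) \<gamma>2(1,2) \<omega> by blast
qed

end
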